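(* For all $i,j\in\{0,1,2\}$, the second-order Riesz transform $S_{ij}=\Delta^{-1}X_iX_j$ is not bounded from $H^1$ to $L^1$.
   Context: **The group.** $G=\mathbb{R}^2\ltimes\mathbb{R}^+$ is the set $\mathbb{R}^2\times(0,\infty)$ with product $(x_1,x_2,a)\cdot(x_1',x_2',a')=(x_1+a x_1',x_2+a x_2',aa')$ and identity $e=(0,0,1)$. The right Haar measure is $d\rho(x_1,x_2,a)=a^{-1}dx_1dx_2da$; $L^p$ and $\|\cdot\|_p$ are taken with respect to $\rho$. The modular function is $\delta(x_1,x_2,a)=a^{-2}$. $d$ is the left-invariant hyperbolic metric on $G$, and $r(x)=d(x,e)$ is given by $\cosh r(x_1,x_2,a)=\frac{a+a^{-1}+a^{-1}(x_1^2+x_2^2)}{2}$. Convolution is $f*g(x)=\int_G f(xy^{-1})g(y)\,d\rho(y)$. **Hardy space.** A Calderón–Zygmund set is a parallelepiped $R=[b_1-L/2,b_1+L/2]\times[b_2-L/2,b_2+L/2]\times[a e^{-r},a e^{r}]$, where $b_1,b_2\in\mathbb{R}$ and $L>0$, $r>0$, $a\in\mathbb{R}^+$ satisfy $e^2ar\le L<e^8ar$ if $r<1$, and $ae^{2r}\le L<ae^{8r}$ if $r\ge1$. An atom is a function $A\in L^1$ supported in a Calderón–Zygmund set $R$ with $\|A\|_\infty\le\rho(R)^{-1}$ and $\int A\,d\rho=0$. $H^1$ is the space of all $f\in L^1$ of the form $f=\sum_j\lambda_jA_j$ with $A_j$ atoms, $\lambda_j\in\mathbb{C}$, $\sum_j|\lambda_j|<\infty$;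 $\|f\|_{H^1}$ is the infimum of $\sum_j|\lambda_j|$ over such decompositions. **Laplacian and Riesz transforms.** Let $X_0=a\partial_a$, $X_1=a\partial_{x_1}$, $X_2=a\partial_{x_2}$ (left-invariant vector fields) and $\Delta=-(X_0^2+X_1^2+X_2^2)$. The operator $\Delta^{-1}$ is regarded as the convolution operator $f\mapsto f*W$ with $W(x)=\frac{1}{4\pi}\delta^{1/2}(x)\frac{1}{\sinh r(x)}$. Thus $S_{ij}f=(X_iX_jf)*W$ for $f\in C_c^\infty(G)$. An operator $T$ defined on $C_c^\infty(G)$ is said to be bounded from $H^1$ to $L^1$ if there is a constant $C$ such that $\|Tf\|_1\le C\|f\|_{H^1}$ for all $f\in C_c^\infty(G)\cap H^1$ (with $\|Tf\|_1=\infty$ if $Tf\notin L^1$). *)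

theory Defs
  imports "HOL-Analysis.Analysis"
begin

text \<open>
  A point \<open>(x1, x2, a)\<close> of the group is a triple of reals with \<open>a > 0\<close>.  The group operations
  and the functions below are total on triples, but only their values on \<open>G\<close> matter.
\<close>

type_synonym point = "real \<times> real \<times> real"

definition G :: "point set" where
  "G = {(x1, x2, a). 0 < a}"

definition g_mult :: "point \<Rightarrow> point \<Rightarrow> point" where
  "g_mult = (\<lambda>(x1, x2, a) (y1, y2, b). (x1 + a * y1, x2 + a * y2, a * b))"

definition g_one :: point where
  "g_one = (0, 0, 1)"

definition g_inv :: "point \<Rightarrow> point" where
  "g_inv = (\<lambda>(x1, x2, a). (- x1 / a, - x2 / a, 1 / a))"

lemma G_group_laws:
  assumes "x \<in> G" "y \<in> G" "z \<in> G"
  shows "g_mult x y \<in> G" "g_one \<in> G" "g_inv x \<in> G"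
    and "g_mult (g_mult x y) z = g_mult x (g_mult y z)"
    and "g_mult g_one x = x" "g_mult x g_one = x"
    and "g_mult (g_inv x) x = g_one" "g_mult x (g_inv x) = g_one"
  using assms
  by (auto simp: G_def g_mult_def g_one_def g_inv_def field_simps split: prod.splits)

definition rho :: "point measure" where
  "rho = density (restrict_space lborel G) (\<lambda>(x1, x2, a). ennreal (1 / a))"

definition modular :: "point \<Rightarrow> real" where
  "modular = (\<lambda>(x1, x2, a). a powr (- 2))"

text \<open>The hyperbolic distance to the identity, through the closed formula for its \<open>cosh\<close>.\<close>

definition r_dist :: "point \<Rightarrow> real" where
  "r_dist = (\<lambda>(x1, x2, a). arcosh ((a + 1 / a + (x1\<^sup>2 + x2\<^sup>2) / a) / 2))"

lemma r_dist_properties: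
  assumes "0 < a"
  shows "0 \<le> r_dist (x1, x2, a)"
    and "cosh (r_dist (x1, x2, a)) = (a + 1 / a + (x1\<^sup>2 + x2\<^sup>2) / a) / 2"
proof -
  have "0 \<le> (a - 1)\<^sup>2 / a + (x1\<^sup>2 + x2\<^sup>2) / a"
    using assms by simp
  also have "(a - 1)\<^sup>2 / a = a + 1 / a - 2"
    using assms by (simp add: field_simps power2_eq_square)
  finally have "1 \<le> (a + 1 / a + (x1\<^sup>2 + x2\<^sup>2) / a) / 2"
    by simp
  then show "0 \<le> r_dist (x1, x2, a)"
    and "cosh (r_dist (x1, x2, a)) = (a + 1 / a + (x1\<^sup>2 + x2\<^sup>2) / a) / 2"
    by (simp_all add: r_dist_def)
qed

definition conv :: "(point \<Rightarrow> complex) \<Rightarrow> (point \<Rightarrow> complex) \<Rightarrow> point \<Rightarrow> complex" where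
  "conv f g x = (LINT y|rho. f (g_mult x (g_inv y)) * g y)"

text \<open>The extended \<open>L\<^sup>1\<close> norm; it is infinite exactly on functions that are not in \<open>L\<^sup>1\<close>.\<close>

definition L1_norm :: "(point \<Rightarrow> complex) \<Rightarrow> ennreal" where
  "L1_norm f = (if integrable rho f then ennreal (LINT x|rho. cmod (f x)) else \<infinity>)"


definition CZ_set :: "point set \<Rightarrow> bool" where
  "CZ_set R \<longleftrightarrow> (\<exists>b1 b2 L r a. 0 < L \<and> 0 < r \<and> 0 < a \<and>
     (if r < 1 then exp 2 * a * r \<le> L \<and> L < exp 8 * a * r
      else a * exp (2 * r) \<le> L \<and> L < a * exp (8 * r)) \<and>
     R = {b1 - L / 2 .. b1 + L / 2} \<times> {b2 - L / 2 .. b2 + L / 2} \<times> {a * exp (- r) .. a * exp r})"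

definition atom :: "(point \<Rightarrow> complex) \<Rightarrow> bool" where
  "atom A \<longleftrightarrow> integrable rho A \<and>
     (\<exists>R. CZ_set R \<and> (AE x in rho. x \<notin> R \<longrightarrow> A x = 0) \<and>
          (AE x in rho. cmod (A x) \<le> 1 / measure rho R)) \<and>
     (LINT x|rho. A x) = 0"

text \<open>
  \<open>f = \<Sum>j. \<lambda>\<^sub>j A\<^sub>j\<close>, with convergence in \<open>L\<^sup>1\<close>.  Finite sums are included, because the zero function
  is an atom.
\<close>

definition atomic_decomposition ::
    "(point \<Rightarrow> complex) \<Rightarrow> (nat \<Rightarrow> complex) \<Rightarrow> (nat \<Rightarrow> point \<Rightarrow> complex) \<Rightarrow> bool" where
  "atomic_decomposition f c A \<longleftrightarrow>
     (\<forall>j. atom (A j)) \<and> summable (\<lambda>j. cmod (c j)) \<and>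
     (\<lambda>n. L1_norm (\<lambda>x. f x - (\<Sum>j<n. c j * A j x))) \<longlonglongrightarrow> 0"

definition H1 :: "(point \<Rightarrow> complex) set" where
  "H1 = {f. integrable rho f \<and> (\<exists>c A. atomic_decomposition f c A)}"

definition H1_norm :: "(point \<Rightarrow> complex) \<Rightarrow> real" where
  "H1_norm f = Inf {(\<Sum>j. cmod (c j)) | c A. atomic_decomposition f c A}"


primrec C_k_on :: "nat \<Rightarrow> point set \<Rightarrow> (point \<Rightarrow> complex) \<Rightarrow> bool" where
  "C_k_on 0 U f \<longleftrightarrow> continuous_on U f"
| "C_k_on (Suc k) U f \<longleftrightarrow>
     (\<forall>x\<in>U. f differentiable (at x)) \<and>
     (\<forall>v. C_k_on k U (\<lambda>x. frechet_derivative f (at x) v))"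

text \<open>
  Elements of \<open>C\<^sub>c\<^sup>\<infinity>(G)\<close> are extended by zero outside \<open>G\<close>; compactness in the half space \<open>G\<close> is
  compactness in \<open>\<real>\<^sup>3\<close> of a subset of \<open>G\<close>.
\<close>

definition Cc_infinity :: "(point \<Rightarrow> complex) set" where
  "Cc_infinity = {f. (\<forall>k. C_k_on k G f) \<and> (\<exists>K. compact K \<and> K \<subseteq> G \<and> (\<forall>x. x \<notin> K \<longrightarrow> f x = 0))}"

text \<open>
  \<open>X 0 = a \<partial>\<^sub>a\<close>, \<open>X 1 = a \<partial>\<^sub>x\<^sub>1\<close> and \<open>X 2 = a \<partial>\<^sub>x\<^sub>2\<close>; the index is only meant to range over \<open>{0, 1, 2}\<close>.
\<close>

definition coord_dir :: "nat \<Rightarrow> point" where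
  "coord_dir i = (if i = 0 then (0, 0, 1) else if i = 1 then (1, 0, 0) else (0, 1, 0))"

definition X :: "nat \<Rightarrow> (point \<Rightarrow> complex) \<Rightarrow> point \<Rightarrow> complex" where
  "X i f = (\<lambda>(x1, x2, a).
     complex_of_real a * frechet_derivative f (at (x1, x2, a)) (coord_dir i))"

text \<open>
  The convolution kernel of the inverse of \<open>\<Delta> = - (X\<^sub>0\<^sup>2 + X\<^sub>1\<^sup>2 + X\<^sub>2\<^sup>2)\<close>.  At the identity
  the division yields the irrelevant value 0.
\<close>

definition W :: "point \<Rightarrow> real" where
  "W x = 1 / (4 * pi) * sqrt (modular x) * (1 / sinh (r_dist x))"

definition Laplacian_inverse :: "(point \<Rightarrow> complex) \<Rightarrow> point \<Rightarrow> complex" where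
  "Laplacian_inverse f = conv f (\<lambda>x. complex_of_real (W x))"

definition Riesz2 :: "nat \<Rightarrow> nat \<Rightarrow> (point \<Rightarrow> complex) \<Rightarrow> point \<Rightarrow> complex" where
  "Riesz2 i j f = Laplacian_inverse (X i (X j f))"

definition bounded_H1_L1 :: "((point \<Rightarrow> complex) \<Rightarrow> point \<Rightarrow> complex) \<Rightarrow> bool" where
  "bounded_H1_L1 T \<longleftrightarrow>
     (\<exists>C\<ge>0. \<forall>f \<in> Cc_infinity \<inter> H1. L1_norm (T f) \<le> ennreal (C * H1_norm f))"

end

theory Submission
  imports Defs
begin

text \<open>
  Every \<open>S\<^sub>i\<^sub>j\<close> already fails on a single function: there is an \<open>f \<in> C\<^sub>c\<^sup>\<infinity>(G) \<inter> H\<^sup>1\<close> with \<open>S\<^sub>i\<^sub>j f \<notin> L\<^sup>1\<close>.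
  The obstruction sits at the boundary \<open>a = 0\<close> of the half space.  Substituting \<open>z = x y\<^sup>-\<^sup>1\<close> in the
  convolution (\<open>Laplacian_inverse_eq\<close>) gives
  \<open>S\<^sub>i\<^sub>j f(x) = \<integral> X\<^sub>i X\<^sub>j f(z) k(x, z) d\<rho>(z)\<close>, where for \<open>x = (x\<^sub>1, x\<^sub>2, a)\<close>, \<open>z = (w\<^sub>1, w\<^sub>2, b)\<close> and
  \<open>s\<^sup>2 = (x\<^sub>1 - w\<^sub>1)\<^sup>2 + (x\<^sub>2 - w\<^sub>2)\<^sup>2\<close>
  \<open>k(x, z) = 1 / (2 \<pi> sqrt (((a - b)\<^sup>2 + s\<^sup>2) ((a + b)\<^sup>2 + s\<^sup>2)))\<close>.
  As \<open>a\<close> tends to \<open>0\<close> this kernel does not decay; it tends to \<open>1 / (2 \<pi> (b\<^sup>2 + s\<^sup>2))\<close>.  Hence \<open>S\<^sub>i\<^sub>j f\<close> extends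
  continuously to \<open>a = 0\<close> (\<open>green_integral_continuous\<close>).  If the extension is nonzero at the boundary
  point \<open>0\<close>, then \<open>\<bar>S\<^sub>i\<^sub>j f\<bar>\<close> is bounded below on a box reaching down to \<open>a = 0\<close>, and such a box has infinite
  measure because \<open>da / a\<close> is not integrable at \<open>0\<close> (\<open>not_integrable_rho_near_boundary\<close>).
  
  It remains to find \<open>f\<close> of mean zero with nonzero boundary value.  Two integrations by parts
  (\<open>Riesz2_boundary_value\<close>) turn the value at \<open>0\<close> into the Lebesgue integral of \<open>f\<close> against the second
  derivative \<open>\<partial>\<^sub>j (b \<partial>\<^sub>i P)\<close> of \<open>P(z) = 1 / (2 \<pi> \<bar>z\<bar>\<^sup>2)\<close>.  For all \<open>i\<close>, \<open>j\<close> that function takes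
  different values at \<open>(1, 1, 1)\<close> and \<open>(0, 0, 1)\<close> (\<open>boundary_kernel_distinguishes\<close>).  Let \<open>f\<close> be the
  difference of equal narrow bumps around these points.  The two bumps are horizontal translates of each
  other and the density of \<open>\<rho>\<close> depends on the height only, so \<open>f\<close> has mean zero and is a multiple of
  an atom; and its boundary value is nonzero if the bumps are narrow enough
  (\<open>bump_difference_integral_nonzero\<close>).
\<close>

section \<open>Smooth bumps\<close>

text \<open>
  All derivatives of \<open>exp (- 1 / t)\<close>, extended by \<open>0\<close> to \<open>t \<le> 0\<close>, are linear combinations of these
  functions, and so are the derivatives of these functions themselves; hence no formula for an
  \<open>n\<close>-th derivative is needed.
\<close>

definition flat_exp :: "nat \<Rightarrow> real \<Rightarrow> real" where
  "flat_exp k t = (if 0 < t then exp (- (1 / t)) / t ^ k else 0)"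

lemma flat_exp_tendsto_0: "(flat_exp k \<longlongrightarrow> 0) (at 0)"
proof -
  have "((\<lambda>s::real. s ^ k / exp s) \<longlongrightarrow> 0) at_top"
    by (rule tendsto_power_div_exp_0)
  then have "((\<lambda>t::real. (inverse t) ^ k / exp (inverse t)) \<longlongrightarrow> 0) (at_right 0)"
    by (rule filterlim_compose[OF _ filterlim_inverse_at_top_right])
  moreover have "\<forall>\<^sub>F t in at_right (0::real). (inverse t) ^ k / exp (inverse t) = flat_exp k t"
    using eventually_at_right_less[of 0]
    by eventually_elim (simp add: flat_exp_def exp_minus field_simps)
  ultimately have right: "(flat_exp k \<longlongrightarrow> 0) (at_right 0)"
    using tendsto_cong by force
  have "\<forall>\<^sub>F t in at_left (0::real). flat_exp k t = 0"
    unfolding eventually_at_filter by (auto simp: flat_exp_def)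
  then have "(flat_exp k \<longlongrightarrow> 0) (at_left 0)"
    by (simp add: tendsto_eventually)
  with right show ?thesis
    by (simp add: filterlim_at_split)
qed

text \<open>
  At \<open>t = 0\<close> the difference quotient of \<open>flat_exp k\<close> is \<open>flat_exp (k + 1)\<close>, which tends to \<open>0\<close>.
\<close>

lemma flat_exp_has_derivative:
  "(flat_exp k has_real_derivative flat_exp (k + 2) t - real k * flat_exp (k + 1) t) (at t)"
proof (cases t "0 :: real" rule: linorder_cases)
  case less
  have "((\<lambda>_. 0) has_real_derivative 0) (at t)" by simp
  then have "(flat_exp k has_real_derivative 0) (at t)"
    by (rule has_field_derivative_transform_within_open[of _ _ _ "{..<0}"])
       (use less in \<open>auto simp: flat_exp_def\<close>)
  with less show ?thesis by (simp add: flat_exp_def)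
next
  case equal
  have "((\<lambda>h. flat_exp (Suc k) h) \<longlongrightarrow> 0) (at 0)"
    by (rule flat_exp_tendsto_0)
  also have "(\<lambda>h. flat_exp (Suc k) h) = (\<lambda>h. (flat_exp k (0 + h) - flat_exp k 0) / h)"
    by (auto simp: flat_exp_def fun_eq_iff)
  finally show ?thesis
    using equal by (simp add: DERIV_def) (simp add: flat_exp_def)
next
  case greater
  let ?e = "exp (- (1 / t))"
  have "((\<lambda>t. exp (- (1 / t))) has_real_derivative ?e / t\<^sup>2) (at t)"
    using greater by (auto intro!: derivative_eq_intros simp: power2_eq_square)
  moreover have "((\<lambda>t. t ^ k) has_real_derivative real k * t ^ (k - 1)) (at t)"
    by (auto intro!: derivative_eq_intros)
  ultimately have "((\<lambda>t. exp (- (1 / t)) / t ^ k) has_real_derivative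
      (?e / t\<^sup>2 * t ^ k - ?e * (real k * t ^ (k - 1))) / (t ^ k * t ^ k)) (at t)"
    using greater by (intro DERIV_divide) auto
  moreover have "(?e / t\<^sup>2 * t ^ k - ?e * (real k * t ^ (k - 1))) / (t ^ k * t ^ k)
      = flat_exp (k + 2) t - real k * flat_exp (k + 1) t"
  proof -
    have "real k * t ^ (k - 1) = real k * t ^ k / t"
      using greater by (cases k) auto
    with greater show ?thesis
      by (simp add: flat_exp_def power_add power2_eq_square diff_divide_distrib)
  qed
  ultimately have "((\<lambda>t. exp (- (1 / t)) / t ^ k) has_real_derivative
      flat_exp (k + 2) t - real k * flat_exp (k + 1) t) (at t)"
    by simp
  then show ?thesis
    by (rule has_field_derivative_transform_within_open[of _ _ _ "{0<..}"])
       (use greater in \<open>auto simp: flat_exp_def\<close>)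
qed

lemma flat_exp_nonneg: "0 \<le> flat_exp k t"
  by (simp add: flat_exp_def)

text \<open>
  Radial bumps supported in \<open>K\<close>, closed under sums and under multiplication by real affine
  functions.  This set is closed under partial derivatives, and under the vector fields \<open>X\<^sub>i\<close> because their
  coefficient is the linear function \<open>a\<close>.  Membership therefore yields smoothness, support in \<open>K\<close>
  and everything that is needed about \<open>X\<^sub>i X\<^sub>j f\<close> by plain rule induction.
\<close>

inductive_set bumps :: "'a::real_inner set \<Rightarrow> ('a \<Rightarrow> complex) set" for K where
  base: "0 < r \<Longrightarrow> cball z r \<subseteq> K \<Longrightarrow>
    (\<lambda>x. of_real (flat_exp k (r\<^sup>2 - (x - z) \<bullet> (x - z)))) \<in> bumps K"
| add: "f \<in> bumps K \<Longrightarrow> g \<in> bumps K \<Longrightarrow> (\<lambda>x. f x + g x) \<in> bumps K"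
| affine: "f \<in> bumps K \<Longrightarrow> (\<lambda>x. of_real (c + x \<bullet> u) * f x) \<in> bumps K"

lemma bumps_scale: "f \<in> bumps K \<Longrightarrow> (\<lambda>x. of_real c * f x) \<in> bumps K"
  using bumps.affine[of f K c 0] by simp

lemma bumps_diff: "f \<in> bumps K \<Longrightarrow> g \<in> bumps K \<Longrightarrow> (\<lambda>x. f x - g x) \<in> bumps K"
  using bumps.add[of f K "\<lambda>x. of_real (-1) * g x"] bumps_scale[of g K "-1"] by simp

lemma bumps_zero_outside:
  assumes "f \<in> bumps K" "x \<notin> K"
  shows "f x = 0"
  using assms
proof induction
  case (base r z k)
  then have "x \<notin> cball z r" by blast
  then have "r < norm (x - z)"
    by (simp add: dist_norm norm_minus_commute)
  then have "r\<^sup>2 < (norm (x - z))\<^sup>2"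
    using \<open>0 < r\<close> by (intro power_strict_mono) auto
  then show ?case by (simp add: flat_exp_def power2_norm_eq_inner)
qed auto

lemma bumps_has_derivative:
  assumes "f \<in> bumps K"
  obtains D where "\<And>x. (f has_derivative D x) (at x)" "\<And>v. (\<lambda>x. D x v) \<in> bumps K"
  using assms
proof (induction arbitrary: thesis)
  case (base r z k)
  let ?q = "\<lambda>x. r\<^sup>2 - (x - z) \<bullet> (x - z)"
  let ?e = "\<lambda>x. flat_exp (k + 2) (?q x) - real k * flat_exp (k + 1) (?q x)"
  show ?case
  proof (rule base.prems)
    fix x
    have q: "(?q has_derivative (\<lambda>v. - 2 * ((x - z) \<bullet> v))) (at x)"
      by (rule derivative_eq_intros refl)+ (simp add: fun_eq_iff inner_commute)
    have e: "(flat_exp k has_derivative (*) (?e x)) (at (?q x))"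
      using flat_exp_has_derivative by (simp add: has_field_derivative_def)
    show "((\<lambda>x. complex_of_real (flat_exp k (?q x))) has_derivative
       (\<lambda>v. of_real (2 * (z \<bullet> v) + x \<bullet> (-2 *\<^sub>R v)) * of_real (?e x))) (at x)"
    proof (rule has_derivative_eq_rhs)
      show "((\<lambda>x. complex_of_real (flat_exp k (?q x))) has_derivative
          (\<lambda>v. of_real (?e x * (- 2 * ((x - z) \<bullet> v))))) (at x)"
        by (rule has_derivative_of_real[OF has_derivative_compose[OF q e]])
      have "- 2 * ((x - z) \<bullet> v) = 2 * (z \<bullet> v) + x \<bullet> (-2 *\<^sub>R v)" for v
        by (simp add: inner_diff_left)
      then show "(\<lambda>v. complex_of_real (?e x * (- 2 * ((x - z) \<bullet> v)))) =
          (\<lambda>v. of_real (2 * (z \<bullet> v) + x \<bullet> (-2 *\<^sub>R v)) * of_real (?e x))"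
        by (simp only: of_real_mult mult.commute)
    qed
  next
    fix v
    have "(\<lambda>x. complex_of_real (flat_exp (k + 2) (?q x)) -
            of_real (real k) * of_real (flat_exp (k + 1) (?q x))) \<in> bumps K"
      by (intro bumps_diff bumps_scale bumps.base base.hyps)
    then show "(\<lambda>x. complex_of_real (2 * (z \<bullet> v) + x \<bullet> (-2 *\<^sub>R v)) * of_real (?e x)) \<in> bumps K"
      unfolding of_real_diff of_real_mult[of "real k"] by (rule bumps.affine)
  qed
next
  case (add f g)
  obtain D where D: "\<And>x. (f has_derivative D x) (at x)" "\<And>v. (\<lambda>x. D x v) \<in> bumps K"
    using add.IH(1) by blast
  obtain D' where D': "\<And>x. (g has_derivative D' x) (at x)" "\<And>v. (\<lambda>x. D' x v) \<in> bumps K"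
    using add.IH(2) by blast
  show ?case
    by (rule add.prems[of "\<lambda>x v. D x v + D' x v"]) (rule has_derivative_add bumps.add D D')+
next
  case (affine f c u)
  obtain D where D: "\<And>x. (f has_derivative D x) (at x)" "\<And>v. (\<lambda>x. D x v) \<in> bumps K"
    using affine.IH by blast
  have d: "((\<lambda>x. complex_of_real (c + x \<bullet> u) * f x) has_derivative
     (\<lambda>v. of_real (c + x \<bullet> u) * D x v + of_real (v \<bullet> u) * f x)) (at x)" for x
    by (rule derivative_eq_intros D refl)+ simp
  show ?case
  proof (rule affine.prems)
    show "((\<lambda>x. complex_of_real (c + x \<bullet> u) * f x) has_derivative
     (\<lambda>v. of_real (c + x \<bullet> u) * D x v + of_real (v \<bullet> u) * f x)) (at x)" for x
      by (rule d)
    show "(\<lambda>x. of_real (c + x \<bullet> u) * D x v + of_real (v \<bullet> u) * f x) \<in> bumps K" for v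
      by (intro bumps.add bumps.affine[OF D(2)] bumps_scale[OF affine.hyps])
  qed
qed

lemma bumps_differentiable: "f \<in> bumps K \<Longrightarrow> f differentiable (at x)"
  by (rule bumps_has_derivative[of f K]) (auto simp: differentiable_def)

lemma bumps_continuous: "f \<in> bumps K \<Longrightarrow> continuous_on U f"
  by (intro continuous_at_imp_continuous_on ballI differentiable_imp_continuous_within bumps_differentiable)

lemma bumps_frechet_derivative:
  assumes "f \<in> bumps K"
  shows "(\<lambda>x. frechet_derivative f (at x) v) \<in> bumps K"
proof -
  obtain D where D: "\<And>x. (f has_derivative D x) (at x)" "\<And>v. (\<lambda>x. D x v) \<in> bumps K"
    using bumps_has_derivative[OF assms] by blast
  have "frechet_derivative f (at x) = D x" for x
    by (rule frechet_derivative_at[OF D(1), symmetric])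
  then show ?thesis by (simp only: D(2))
qed

lemma bumps_C_k_on: "f \<in> bumps K \<Longrightarrow> C_k_on k U f"
  by (induction k arbitrary: f)
     (simp_all add: bumps_continuous bumps_differentiable bumps_frechet_derivative)

lemma bumps_Cc_infinity:
  assumes "f \<in> bumps K" "compact K" "K \<subseteq> G"
  shows "f \<in> Cc_infinity"
  unfolding Cc_infinity_def
  by (intro CollectI conjI allI exI[of _ K] impI assms bumps_C_k_on[OF assms(1)]
      bumps_zero_outside[OF assms(1)])

lemma bumps_X:
  assumes "f \<in> bumps K"
  shows "X i f \<in> bumps K"
proof -
  have "X i f = (\<lambda>x. of_real (0 + x \<bullet> (0, 0, 1)) * frechet_derivative f (at x) (coord_dir i))"
    by (auto simp: X_def fun_eq_iff)
  then show ?thesis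
    by (simp only:) (rule bumps.affine[OF bumps_frechet_derivative[OF assms]])
qed

section \<open>Integration by parts for compactly supported functions\<close>

lemma compact_support_integral:
  fixes g :: "'a::euclidean_space \<Rightarrow> complex"
  assumes "continuous_on (cbox a b) g" and "\<And>x. x \<notin> cbox a b \<Longrightarrow> g x = 0"
  shows "integrable lborel g" "(LINT x|lborel. g x) = integral (cbox a b) g"
proof -
  have "set_integrable lborel (cbox a b) g"
    unfolding set_integrable_def
    by (intro borel_integrable_compact compact_cbox assms(1))
  moreover have "(\<lambda>x. indicator (cbox a b) x *\<^sub>R g x) = g"
    using assms(2) by (auto simp: fun_eq_iff indicator_def)
  ultimately show "integrable lborel g" "(LINT x|lborel. g x) = integral (cbox a b) g"
    using set_borel_integral_eq_integral(2)[of "cbox a b" g]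
    by (simp_all add: set_integrable_def set_lebesgue_integral_def)
qed

text \<open>
  By translation invariance \<open>t \<mapsto> \<integral> f (x + t v) dx\<close> is constant; differentiating under the integral
  sign at \<open>t = 0\<close> gives the claim without reducing to one variable.
\<close>

lemma integral_directional_derivative_eq_0:
  fixes f :: "'a::euclidean_space \<Rightarrow> complex"
  assumes der: "\<And>x. (f has_derivative D x) (at x)" and cont: "continuous_on UNIV (\<lambda>x. D x v)"
    and K: "bounded K" "\<And>x. x \<notin> K \<Longrightarrow> f x = 0" "\<And>x. x \<notin> K \<Longrightarrow> D x v = 0"
  shows "(LINT x|lborel. D x v) = 0"
proof -
  obtain B where B: "\<And>x. x \<in> K \<Longrightarrow> norm x \<le> B"
    using K(1) by (auto simp: bounded_iff)
  obtain a b where ab: "cball 0 (B + norm v) \<subseteq> cbox a (b::'a)"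
    using bounded_subset_cbox_symmetric[OF bounded_cball] by metis
  have out: "x + t *\<^sub>R v \<notin> K" if "x \<notin> cbox a b" "\<bar>t\<bar> < 1" for x t
  proof
    assume "x + t *\<^sub>R v \<in> K"
    then have "norm (x + t *\<^sub>R v) \<le> B" by (rule B)
    moreover have "norm (t *\<^sub>R v) \<le> norm v" using that(2) by (simp add: mult_left_le_one_le)
    moreover have "norm x \<le> norm (x + t *\<^sub>R v) + norm (t *\<^sub>R v)"
      using norm_triangle_ineq4[of "x + t *\<^sub>R v" "t *\<^sub>R v"] by simp
    ultimately have "x \<in> cball 0 (B + norm v)" by simp
    with ab that(1) show False by blast
  qed
  have contf: "continuous_on UNIV f"
    using der by (auto intro!: continuous_at_imp_continuous_on has_derivative_continuous)
  have const: "integral (cbox a b) (\<lambda>x. f (x + t *\<^sub>R v)) = (LINT x|lborel. f x)" if "\<bar>t\<bar> < 1" for t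
  proof -
    have "(LINT x|lborel. f x) = (LINT x|distr lborel borel ((+) (t *\<^sub>R v)). f x)"
      by (simp only: lborel_distr_plus)
    also have "\<dots> = (LINT x|lborel. f (x + t *\<^sub>R v))"
      using borel_measurable_continuous_onI[OF contf] by (subst integral_distr) (simp_all add: add.commute)
    also have "\<dots> = integral (cbox a b) (\<lambda>x. f (x + t *\<^sub>R v))"
      using out[OF _ that] K(2)
      by (intro compact_support_integral continuous_on_compose2[OF contf] continuous_intros) auto
    finally show ?thesis by simp
  qed
  have "((\<lambda>t. integral (cbox a b) (\<lambda>x. f (x + t *\<^sub>R v))) has_vector_derivative
      integral (cbox a b) (\<lambda>x. D (x + 0 *\<^sub>R v) v)) (at 0 within {-1<..<1})"
  proof (rule leibniz_rule_vector_derivative)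
    fix t :: real and x :: 'a
    have "((\<lambda>t. x + t *\<^sub>R v) has_derivative (\<lambda>t. t *\<^sub>R v)) (at t)"
      by (auto intro!: derivative_eq_intros)
    from has_derivative_compose[OF this der]
    have "((\<lambda>t. f (x + t *\<^sub>R v)) has_derivative (\<lambda>s. D (x + t *\<^sub>R v) (s *\<^sub>R v))) (at t)" .
    moreover have "D (x + t *\<^sub>R v) (s *\<^sub>R v) = s *\<^sub>R D (x + t *\<^sub>R v) v" for s
      using linear_scale[OF has_derivative_linear[OF der]] by metis
    ultimately show "((\<lambda>t. f (x + t *\<^sub>R v)) has_vector_derivative D (x + t *\<^sub>R v) v)
        (at t within {-1<..<1})"
      by (simp add: has_vector_derivative_def has_derivative_at_withinI)
  next
    show "(\<lambda>x. f (x + t *\<^sub>R v)) integrable_on cbox a b" for t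
      by (intro integrable_continuous continuous_on_compose2[OF contf] continuous_intros) auto
    show "continuous_on ({-1<..<1} \<times> cbox a b) (\<lambda>(t, x). D (x + t *\<^sub>R v) v)"
      unfolding case_prod_beta
      by (intro continuous_on_compose2[OF cont] continuous_intros) auto
  qed auto
  then have "((\<lambda>t. LINT x|lborel. f x) has_vector_derivative integral (cbox a b) (\<lambda>x. D x v)) (at 0)"
    using const
    by (subst (asm) has_vector_derivative_within_open)
       (auto elim!: has_vector_derivative_transform_within_open[where S = "{-1<..<1}"])
  then have "integral (cbox a b) (\<lambda>x. D x v) = 0"
    using vector_derivative_unique_at has_vector_derivative_const by blast
  moreover have "(LINT x|lborel. D x v) = integral (cbox a b) (\<lambda>x. D x v)"
    using out[of _ 0] K(3) by (intro compact_support_integral continuous_on_subset[OF cont]) auto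
  ultimately show ?thesis by simp
qed

lemma continuous_on_times_of_support:
  fixes h :: "'a::euclidean_space \<Rightarrow> complex" and P :: "'a \<Rightarrow> complex"
  assumes "continuous_on UNIV h" "\<And>x. x \<notin> K \<Longrightarrow> h x = 0" "closed K" "open U" "K \<subseteq> U"
    "continuous_on U P"
  shows "continuous_on UNIV (\<lambda>x. h x * P x)"
proof -
  have "continuous_on U (\<lambda>x. h x * P x)"
    using assms by (intro continuous_on_mult continuous_on_subset[OF assms(1)]) auto
  moreover have "continuous_on (- K) (\<lambda>x. h x * P x)"
    by (rule continuous_on_eq[of _ "\<lambda>_. 0"]) (use assms(2) in auto)
  ultimately have "continuous_on (U \<union> - K) (\<lambda>x. h x * P x)"
    using assms by (intro continuous_on_open_Un) auto
  moreover have "U \<union> - K = UNIV" using assms(5) by auto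
  ultimately show ?thesis by simp
qed

text \<open>
  \<open>P\<close> may be singular off the support of \<open>h\<close>: the product \<open>h P\<close>, extended by zero, is
  differentiable everywhere with a continuous derivative along \<open>v\<close>.  This is used with \<open>P\<close> singular at the origin, which lies on the boundary of \<open>G\<close>.
\<close>

lemma bumps_integration_by_parts:
  fixes h :: "'a::euclidean_space \<Rightarrow> complex" and P :: "'a \<Rightarrow> complex"
  assumes h: "h \<in> bumps K" and K: "compact K" "open U" "K \<subseteq> U"
    and P: "\<And>x. x \<in> U \<Longrightarrow> (P has_derivative D x) (at x)" "continuous_on U (\<lambda>x. D x v)"
  shows "(LINT x|lborel. frechet_derivative h (at x) v * P x) = - (LINT x|lborel. h x * D x v)"
proof -
  let ?d = "\<lambda>x v. h x * D x v + frechet_derivative h (at x) v * P x"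
  have contP: "continuous_on U P"
    using P(1) by (auto intro!: continuous_at_imp_continuous_on has_derivative_continuous)
  note h' = bumps_frechet_derivative[OF h, of v]
  have der: "((\<lambda>x. h x * P x) has_derivative (if x \<in> K then ?d x else (\<lambda>_. 0))) (at x)" for x
  proof (cases "x \<in> K")
    case True
    with K P(1) have "(P has_derivative D x) (at x)" by blast
    from has_derivative_mult[OF bumps_differentiable[OF h, THEN frechet_derivative_works[THEN iffD1]] this] True
    show ?thesis by simp
  next
    case False
    have "((\<lambda>x. h x * P x) has_derivative (\<lambda>_. 0)) (at x)"
      by (rule has_derivative_transform_within_open[of "\<lambda>_. 0" _ _ _ "- K"])
         (use False K(1) bumps_zero_outside[OF h] in \<open>auto simp: compact_imp_closed\<close>)
    with False show ?thesis by simp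
  qed
  have eq: "(if x \<in> K then ?d x else (\<lambda>_. 0)) v = ?d x v" for x
    using bumps_zero_outside[OF h] bumps_zero_outside[OF h'] by auto
  have cont1: "continuous_on UNIV (\<lambda>x. h x * D x v)"
    by (rule continuous_on_times_of_support[of _ K U])
       (use K P h bumps_continuous bumps_zero_outside in \<open>auto simp: compact_imp_closed\<close>)
  have cont2: "continuous_on UNIV (\<lambda>x. frechet_derivative h (at x) v * P x)"
    by (rule continuous_on_times_of_support[of _ K U])
       (use K contP h' bumps_continuous bumps_zero_outside in \<open>auto simp: compact_imp_closed\<close>)
  obtain a b where ab: "K \<subseteq> cbox a b"
    using bounded_subset_cbox_symmetric[OF compact_imp_bounded[OF K(1)]] by metis
  have "(LINT x|lborel. ?d x v) = 0"
  proof -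
    have "(LINT x|lborel. (if x \<in> K then ?d x else (\<lambda>_. 0)) v) = 0"
      by (rule integral_directional_derivative_eq_0[OF der, of _ K])
         (use cont1 cont2 K(1) bumps_zero_outside[OF h] in
           \<open>auto simp: eq compact_imp_bounded intro!: continuous_on_add\<close>)
    then show ?thesis by (simp only: eq)
  qed
  moreover have "integrable lborel (\<lambda>x. h x * D x v)"
    by (rule compact_support_integral(1)[OF continuous_on_subset[OF cont1 subset_UNIV], of a b])
       (use ab bumps_zero_outside[OF h] in auto)
  moreover have "integrable lborel (\<lambda>x. frechet_derivative h (at x) v * P x)"
    by (rule compact_support_integral(1)[OF continuous_on_subset[OF cont2 subset_UNIV], of a b])
       (use ab bumps_zero_outside[OF h'] in auto)
  ultimately show ?thesis
    by (simp add: eq_neg_iff_add_eq_0 add.commute)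
qed

section \<open>The right Haar measure\<close>

lemma G_borel [measurable]: "G \<in> sets borel"
proof -
  have "G = {z. 0 < snd (snd z)}" by (auto simp: G_def)
  also have "open \<dots>" by (intro open_Collect_less continuous_intros)
  finally show ?thesis by simp
qed

lemma snd_snd_measurable [measurable]: "(\<lambda>z::point. snd (snd z)) \<in> borel_measurable borel"
  and fst_snd_measurable [measurable]: "(\<lambda>z::point. fst (snd z)) \<in> borel_measurable borel"
  and fst_point_measurable [measurable]: "(\<lambda>z::point. fst z) \<in> borel_measurable borel"
  by (intro borel_measurable_continuous_onI continuous_intros)+

lemma rho_eq: "rho = density (restrict_space lborel G) (\<lambda>z. ennreal (1 / snd (snd z)))"
  unfolding rho_def by (simp add: case_prod_unfold)

lemma space_rho [simp]: "space rho = G"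
  by (simp add: rho_eq space_restrict_space)

lemma sets_rho: "sets rho = sets (restrict_space borel G)"
  by (simp add: rho_eq cong: sets_restrict_space_cong)

lemma measurable_rho:
  "f \<in> measurable borel N \<Longrightarrow> f \<in> measurable rho N"
  using measurable_restrict_space1 measurable_cong_sets[OF sets_rho refl] by blast

lemma nn_integral_rho:
  assumes f [measurable]: "f \<in> borel_measurable borel"
  shows "(\<integral>\<^sup>+z. f z \<partial>rho) = (\<integral>\<^sup>+z. f z * (indicator G z * ennreal (1 / snd (snd z))) \<partial>lborel)"
proof -
  have m: "(\<lambda>z. ennreal (1 / snd (snd z))) \<in> borel_measurable (restrict_space lborel G)"
    "f \<in> borel_measurable (restrict_space lborel G)"
    by (auto intro!: measurable_restrict_space1)
  have "(\<integral>\<^sup>+z. f z \<partial>rho) = (\<integral>\<^sup>+z. ennreal (1 / snd (snd z)) * f z \<partial>restrict_space lborel G)"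
    unfolding rho_eq using m by (rule nn_integral_density)
  also have "\<dots> = (\<integral>\<^sup>+z. ennreal (1 / snd (snd z)) * f z * indicator G z \<partial>lborel)"
    by (rule nn_integral_restrict_space) simp
  finally show ?thesis by (simp add: ac_simps)
qed

lemma integral_rho:
  fixes f :: "point \<Rightarrow> complex"
  assumes f [measurable]: "f \<in> borel_measurable borel"
  shows "(LINT z|rho. f z) = (LINT z|lborel. (indicator G z / snd (snd z)) *\<^sub>R f z)"
    and "integrable rho f \<longleftrightarrow> integrable lborel (\<lambda>z. (indicator G z / snd (snd z)) *\<^sub>R f z)"
proof -
  have m: "(\<lambda>z. 1 / snd (snd z)) \<in> borel_measurable (restrict_space lborel G)"
    "f \<in> borel_measurable (restrict_space lborel G)"
    by (auto intro!: measurable_restrict_space1)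
  have ae: "AE z in restrict_space lborel G. 0 \<le> 1 / snd (snd z)"
    by (rule AE_I2) (auto simp: space_restrict_space G_def)
  have "(LINT z|rho. f z) = (LINT z|restrict_space lborel G. (1 / snd (snd z)) *\<^sub>R f z)"
    unfolding rho_eq using m(2) m(1) ae by (rule integral_density)
  also have "\<dots> = (LINT z|lborel. indicator G z *\<^sub>R (1 / snd (snd z)) *\<^sub>R f z)"
    by (rule integral_restrict_space) simp
  finally show "(LINT z|rho. f z) = (LINT z|lborel. (indicator G z / snd (snd z)) *\<^sub>R f z)"
    by simp
  have "integrable rho f \<longleftrightarrow> integrable (restrict_space lborel G) (\<lambda>z. (1 / snd (snd z)) *\<^sub>R f z)"
    unfolding rho_eq using m(2) m(1) ae by (rule integrable_density)
  also have "\<dots> \<longleftrightarrow> integrable lborel (\<lambda>z. indicator G z *\<^sub>R (1 / snd (snd z)) *\<^sub>R f z)"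
    by (rule integrable_restrict_space) simp
  finally show "integrable rho f \<longleftrightarrow> integrable lborel (\<lambda>z. (indicator G z / snd (snd z)) *\<^sub>R f z)"
    by simp
qed

lemma nn_integral_triple:
  fixes f :: "point \<Rightarrow> ennreal"
  assumes f [measurable]: "f \<in> borel_measurable borel"
  shows "(\<integral>\<^sup>+z. f z \<partial>lborel) = (\<integral>\<^sup>+x. \<integral>\<^sup>+y. \<integral>\<^sup>+a. f (x, y, a) \<partial>lborel \<partial>lborel \<partial>lborel)"
proof -
  have [measurable]: "f \<in> borel_measurable (borel \<Otimes>\<^sub>M borel \<Otimes>\<^sub>M borel)"
    by (simp add: borel_prod)
  have pair: "(\<integral>\<^sup>+p. h p \<partial>lborel) = (\<integral>\<^sup>+x. \<integral>\<^sup>+y. h (x, y) \<partial>lborel \<partial>lborel)"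
    if "h \<in> borel_measurable borel" for h :: "'a::euclidean_space \<times> 'b::euclidean_space \<Rightarrow> ennreal"
    using lborel.nn_integral_fst[of h "lborel :: 'a measure"] that by (simp add: lborel_prod)
  have m: "(\<lambda>p. f (x, p)) \<in> borel_measurable borel" for x
    unfolding borel_prod[symmetric] by measurable
  show ?thesis
    by (simp only: pair[OF f] pair[OF m])
qed

lemma nn_integral_swap:
  fixes f :: "'a::euclidean_space \<Rightarrow> 'b::euclidean_space \<Rightarrow> ennreal"
  assumes "case_prod f \<in> borel_measurable borel"
  shows "(\<integral>\<^sup>+x. \<integral>\<^sup>+y. f x y \<partial>lborel \<partial>lborel) = (\<integral>\<^sup>+y. \<integral>\<^sup>+x. f x y \<partial>lborel \<partial>lborel)"
proof -
  show ?thesis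
    using assms by (intro lborel_pair.Fubini'[symmetric]) (simp add: lborel_prod)
qed

text \<open>
  Translates a change of variables for absolutely integrable functions into one for nonnegative
  integrals, where both sides may be infinite.
\<close>

lemma nn_integral_eq_if_same_integral:
  fixes f g :: "real \<Rightarrow> real"
  assumes nonneg: "\<And>x. x \<in> S \<Longrightarrow> 0 \<le> f x" "\<And>x. x \<in> S \<Longrightarrow> 0 \<le> g x"
    and m [measurable]: "f \<in> borel_measurable borel" "g \<in> borel_measurable borel" "S \<in> sets borel"
    and iff: "\<And>b. f absolutely_integrable_on S \<and> integral S f = b \<longleftrightarrow>
      g absolutely_integrable_on S \<and> integral S g = b"
  shows "(\<integral>\<^sup>+x. ennreal (f x) * indicator S x \<partial>lborel) = (\<integral>\<^sup>+x. ennreal (g x) * indicator S x \<partial>lborel)"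
proof -
  have fin: "(\<integral>\<^sup>+x. ennreal (h x) * indicator S x \<partial>lborel) =
      (if h absolutely_integrable_on S then ennreal (integral S h) else \<infinity>)"
    if h: "\<And>x. x \<in> S \<Longrightarrow> 0 \<le> h x" and [measurable]: "h \<in> borel_measurable borel" for h :: "real \<Rightarrow> real"
  proof -
    have eq: "(\<integral>\<^sup>+x. ennreal (h x) * indicator S x \<partial>lborel) = (\<integral>\<^sup>+x. ennreal (indicator S x *\<^sub>R h x) \<partial>lborel)"
      by (intro nn_integral_cong) (auto split: split_indicator)
    have abs_iff: "h absolutely_integrable_on S \<longleftrightarrow> integrable lborel (\<lambda>x. indicator S x *\<^sub>R h x)"
      by (simp add: set_integrable_def integrable_completion)
    have nn: "0 \<le> indicator S x *\<^sub>R h x" for x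
      using h by (auto split: split_indicator)
    show ?thesis
    proof (cases "h absolutely_integrable_on S")
      case True
      then have i: "integrable lborel (\<lambda>x. indicator S x *\<^sub>R h x)" by (simp only: abs_iff)
      have "integral S h = (LINT x:S|lborel. h x)"
        using i by (intro set_borel_integral_eq_integral(2)[symmetric]) (simp add: set_integrable_def)
      with True i show ?thesis
        unfolding eq using nn by (simp add: nn_integral_eq_integral set_lebesgue_integral_def)
    next
      case False
      have "(\<integral>\<^sup>+x. ennreal (indicator S x *\<^sub>R h x) \<partial>lborel) = \<infinity>"
      proof (rule ccontr)
        assume "(\<integral>\<^sup>+x. ennreal (indicator S x *\<^sub>R h x) \<partial>lborel) \<noteq> \<infinity>"
        then have "(\<integral>\<^sup>+x. ennreal (indicator S x *\<^sub>R h x) \<partial>lborel) < \<infinity>"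
          by (simp add: less_top)
        then have "integrable lborel (\<lambda>x. indicator S x *\<^sub>R h x)"
          using nn by (intro integrableI_nonneg AE_I2) auto
        with False abs_iff show False by blast
      qed
      with False show ?thesis by (simp only: eq if_False)
    qed
  qed
  have "f absolutely_integrable_on S \<longleftrightarrow> g absolutely_integrable_on S"
    "f absolutely_integrable_on S \<Longrightarrow> integral S f = integral S g"
    using iff by blast+
  moreover note fin[of f, OF nonneg(1) m(1)] fin[of g, OF nonneg(2) m(2)]
  ultimately show ?thesis by (simp only: if_cancel split: if_split) simp
qed

text \<open>
  The multiplicative Haar measure \<open>dc / c\<close> of the positive reals is invariant under \<open>c \<mapsto> a / c\<close>.
\<close>

lemma nn_integral_inversion:
  fixes f :: "real \<Rightarrow> ennreal"
  assumes f [measurable]: "f \<in> borel_measurable borel" and a: "0 < a"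
  shows "(\<integral>\<^sup>+c. f (a / c) * (indicator {0<..} c * ennreal (1 / c)) \<partial>lborel) =
    (\<integral>\<^sup>+b. f b * (indicator {0<..} b * ennreal (1 / b)) \<partial>lborel)"
proof -
  let ?M = "density lborel (\<lambda>c::real. indicator {0<..} c * ennreal (1 / c))"
  have "distr ?M borel (\<lambda>c. a / c) = ?M"
  proof (rule measure_eqI)
    fix A assume "A \<in> sets (distr ?M borel (\<lambda>c. a / c))"
    then have [measurable]: "A \<in> sets borel" by simp
    let ?S = "{0::real<..}"
    have "(\<lambda>c. \<bar>- a / c\<^sup>2\<bar> * (indicator A (a / c) / (a / c))) absolutely_integrable_on ?S \<and>
        integral ?S (\<lambda>c. \<bar>- a / c\<^sup>2\<bar> * (indicator A (a / c) / (a / c))) = b \<longleftrightarrow>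
      (\<lambda>b. indicator A b / b) absolutely_integrable_on ((\<lambda>c. a / c) ` ?S) \<and>
        integral ((\<lambda>c. a / c) ` ?S) (\<lambda>b. indicator A b / b :: real) = b" for b
      using a by (intro has_absolute_integral_change_of_variables_1')
        (auto intro!: derivative_eq_intros inj_onI simp: power2_eq_square field_simps)
    moreover have "(\<lambda>c. a / c) ` ?S = ?S"
    proof (intro equalityI subsetI)
      fix b assume "b \<in> ?S"
      then have "b = a / (a / b)" "a / b \<in> ?S" using a by auto
      then show "b \<in> (\<lambda>c. a / c) ` ?S" by blast
    qed (use a in auto)
    moreover have e: "\<bar>- a / c\<^sup>2\<bar> * (indicator A (a / c) / (a / c)) = indicator A (a / c) / c"
      if "c \<in> ?S" for c :: real
      using that a by (simp add: power2_eq_square)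
    have "(\<lambda>c. \<bar>- a / c\<^sup>2\<bar> * (indicator A (a / c) / (a / c))) absolutely_integrable_on ?S \<longleftrightarrow>
        (\<lambda>c. indicator A (a / c) / c :: real) absolutely_integrable_on ?S"
      by (intro set_integrable_cong refl e)
    moreover have "integral ?S (\<lambda>c. \<bar>- a / c\<^sup>2\<bar> * (indicator A (a / c) / (a / c))) =
        integral ?S (\<lambda>c. indicator A (a / c) / c :: real)"
      by (intro integral_cong e)
    ultimately have iff: "(\<lambda>c. indicator A (a / c) / c :: real) absolutely_integrable_on ?S \<and>
        integral ?S (\<lambda>c. indicator A (a / c) / c :: real) = b \<longleftrightarrow>
      (\<lambda>b. indicator A b / b) absolutely_integrable_on ?S \<and>
        integral ?S (\<lambda>b. indicator A b / b :: real) = b" for b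
      by (simp only:)
    have "emeasure (distr ?M borel (\<lambda>c. a / c)) A = (\<integral>\<^sup>+c. indicator A c \<partial>distr ?M borel (\<lambda>c. a / c))"
      by simp
    also have "\<dots> = (\<integral>\<^sup>+c. (indicator ?S c * ennreal (1 / c)) * indicator A (a / c) \<partial>lborel)"
      by (subst nn_integral_distr; (subst nn_integral_density)?; measurable)
    also have "\<dots> = (\<integral>\<^sup>+c. ennreal (indicator A (a / c) / c) * indicator ?S c \<partial>lborel)"
      by (intro nn_integral_cong) (auto split: split_indicator)
    also have "\<dots> = (\<integral>\<^sup>+b. ennreal (indicator A b / b) * indicator ?S b \<partial>lborel)"
      by (rule nn_integral_eq_if_same_integral[OF _ _ _ _ _ iff]) auto
    also have "\<dots> = (\<integral>\<^sup>+c. (indicator ?S c * ennreal (1 / c)) * indicator A c \<partial>lborel)"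
      by (intro nn_integral_cong) (auto split: split_indicator)
    also have "\<dots> = emeasure ?M A"
      by (subst emeasure_density) auto
    finally show "emeasure (distr ?M borel (\<lambda>c. a / c)) A = emeasure ?M A" .
  qed simp
  then have "(\<integral>\<^sup>+b. f b \<partial>distr ?M borel (\<lambda>c. a / c)) = (\<integral>\<^sup>+b. f b \<partial>?M)" by simp
  then show ?thesis
    by (simp add: nn_integral_distr nn_integral_density mult.commute)
qed

lemma nn_integral_reflect_scale:
  fixes f :: "real \<Rightarrow> ennreal"
  assumes "f \<in> borel_measurable borel" "0 < b"
  shows "(\<integral>\<^sup>+y. f (t - y * b) \<partial>lborel) = ennreal (1 / b) * (\<integral>\<^sup>+w. f w \<partial>lborel)"
proof -
  have "(\<integral>\<^sup>+w. f w \<partial>lborel) = ennreal b * (\<integral>\<^sup>+y. f (t - y * b) \<partial>lborel)"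
    using nn_integral_real_affine[OF assms(1), of "- b" t] assms(2) by (simp add: mult.commute)
  then have "ennreal (1 / b) * (\<integral>\<^sup>+w. f w \<partial>lborel)
      = ennreal (1 / b) * ennreal b * (\<integral>\<^sup>+y. f (t - y * b) \<partial>lborel)"
    by (simp add: mult.assoc)
  also have "ennreal (1 / b) * ennreal b = 1"
    using assms(2) by (simp flip: ennreal_mult')
  finally show ?thesis by simp
qed

lemma g_mult_g_inv_measurable [measurable]:
  "(\<lambda>y. g_mult x (g_inv y)) \<in> borel_measurable borel"
proof -
  obtain x1 x2 a where x: "x = (x1, x2, a)" by (cases x)
  have "(\<lambda>y. g_mult x (g_inv y)) =
     (\<lambda>y. (x1 + a * (- fst y / snd (snd y)), x2 + a * (- fst (snd y) / snd (snd y)), a * (1 / snd (snd y))))"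
    by (auto simp: x g_mult_def g_inv_def)
  also have "\<dots> \<in> borel_measurable borel"
    by (intro borel_measurable_Pair; measurable)
  finally show ?thesis .
qed

text \<open>
  The map \<open>y \<mapsto> x y\<^sup>-\<^sup>1\<close> sends the right Haar measure to the left Haar measure, whose density with
  respect to Lebesgue measure is \<open>b\<^sup>-\<^sup>3\<close> at height \<open>b\<close>.  In coordinates
  \<open>x y\<^sup>-\<^sup>1 = (x\<^sub>1 - y\<^sub>1 a / c, x\<^sub>2 - y\<^sub>2 a / c, a / c)\<close>: the height \<open>b = a / c\<close> is substituted first, and for
  fixed \<open>b\<close> each horizontal coordinate is an affine substitution that contributes a factor \<open>1 / b\<close>.
\<close>

lemma nn_integral_rho_reflection:
  assumes f [measurable]: "f \<in> borel_measurable borel" and x: "x \<in> G"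
  shows "(\<integral>\<^sup>+y. f (g_mult x (g_inv y)) \<partial>rho) =
    (\<integral>\<^sup>+z. f z * (indicator G z * ennreal (1 / snd (snd z) ^ 3)) \<partial>lborel)"
proof -
  obtain x1 x2 a where xa: "x = (x1, x2, a)" and a: "0 < a" using x by (auto simp: G_def)
  let ?w = "\<lambda>b::real. indicator {0<..} b * ennreal (1 / b)"
  have m: "(\<lambda>y. f (g_mult x (g_inv y))) \<in> borel_measurable borel"
    by measurable
  have m': "(\<lambda>y. f (g_mult x (g_inv y)) * (indicator G y * ennreal (1 / snd (snd y)))) \<in> borel_measurable borel"
    by measurable
  have fm [measurable]: "f \<in> borel_measurable (borel \<Otimes>\<^sub>M borel \<Otimes>\<^sub>M borel)"
    by (simp add: borel_prod)
  have "(\<integral>\<^sup>+y. f (g_mult x (g_inv y)) \<partial>rho) =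
      (\<integral>\<^sup>+y1. \<integral>\<^sup>+y2. \<integral>\<^sup>+c. f (g_mult x (g_inv (y1, y2, c))) * (indicator G (y1, y2, c) * ennreal (1 / c))
        \<partial>lborel \<partial>lborel \<partial>lborel)"
    unfolding nn_integral_rho[OF m] nn_integral_triple[OF m'] by simp
  also have "\<dots> = (\<integral>\<^sup>+y1. \<integral>\<^sup>+y2. \<integral>\<^sup>+c. f (x1 - y1 * (a / c), x2 - y2 * (a / c), a / c) * ?w c
        \<partial>lborel \<partial>lborel \<partial>lborel)"
    by (intro nn_integral_cong) (auto simp: xa g_mult_def g_inv_def G_def ac_simps split: split_indicator)
  also have "\<dots> = (\<integral>\<^sup>+y1. \<integral>\<^sup>+y2. \<integral>\<^sup>+b. f (x1 - y1 * b, x2 - y2 * b, b) * ?w b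
        \<partial>lborel \<partial>lborel \<partial>lborel)"
  proof (rule nn_integral_cong, rule nn_integral_cong)
    fix y1 y2 :: real
    show "(\<integral>\<^sup>+c. f (x1 - y1 * (a / c), x2 - y2 * (a / c), a / c) * ?w c \<partial>lborel) =
        (\<integral>\<^sup>+b. f (x1 - y1 * b, x2 - y2 * b, b) * ?w b \<partial>lborel)"
      by (rule nn_integral_inversion[OF _ a, where f = "\<lambda>b. f (x1 - y1 * b, x2 - y2 * b, b)"]) measurable
  qed
  also have "\<dots> = (\<integral>\<^sup>+y1. \<integral>\<^sup>+b. \<integral>\<^sup>+y2. f (x1 - y1 * b, x2 - y2 * b, b) * ?w b
        \<partial>lborel \<partial>lborel \<partial>lborel)"
    by (rule nn_integral_cong, rule nn_integral_swap) (simp add: borel_prod[symmetric])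
  also have "\<dots> = (\<integral>\<^sup>+y1. \<integral>\<^sup>+b. \<integral>\<^sup>+w2. f (x1 - y1 * b, w2, b) * (?w b * ennreal (1 / b))
        \<partial>lborel \<partial>lborel \<partial>lborel)"
  proof (rule nn_integral_cong, rule nn_integral_cong)
    fix y1 b :: real
    show "(\<integral>\<^sup>+y2. f (x1 - y1 * b, x2 - y2 * b, b) * ?w b \<partial>lborel) =
      (\<integral>\<^sup>+w2. f (x1 - y1 * b, w2, b) * (?w b * ennreal (1 / b)) \<partial>lborel)"
    proof (cases "0 < b")
      case True
      have m: "(\<lambda>w. f (x1 - y1 * b, w, b) * ?w b) \<in> borel_measurable borel" by measurable
      show ?thesis
        unfolding nn_integral_reflect_scale[OF m True]
        by (subst nn_integral_cmult[symmetric], measurable) (simp add: ac_simps)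
    qed simp
  qed
  also have "\<dots> = (\<integral>\<^sup>+b. \<integral>\<^sup>+y1. \<integral>\<^sup>+w2. f (x1 - y1 * b, w2, b) * (?w b * ennreal (1 / b))
        \<partial>lborel \<partial>lborel \<partial>lborel)"
    by (rule nn_integral_swap) (simp add: borel_prod[symmetric])
  also have "\<dots> = (\<integral>\<^sup>+b. \<integral>\<^sup>+w1. \<integral>\<^sup>+w2. f (w1, w2, b) * (indicator {0<..} b * ennreal (1 / b ^ 3))
        \<partial>lborel \<partial>lborel \<partial>lborel)"
  proof (rule nn_integral_cong)
    fix b :: real
    show "(\<integral>\<^sup>+y1. \<integral>\<^sup>+w2. f (x1 - y1 * b, w2, b) * (?w b * ennreal (1 / b)) \<partial>lborel \<partial>lborel) =
      (\<integral>\<^sup>+w1. \<integral>\<^sup>+w2. f (w1, w2, b) * (indicator {0<..} b * ennreal (1 / b ^ 3)) \<partial>lborel \<partial>lborel)"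
    proof (cases "0 < b")
      case True
      have e: "ennreal (1 / b) * (ennreal (1 / b) * ennreal (1 / b)) = ennreal (1 / b ^ 3)"
        using True by (simp add: power3_eq_cube flip: ennreal_mult')
      have m: "(\<lambda>w1. \<integral>\<^sup>+w2. f (w1, w2, b) * (?w b * ennreal (1 / b)) \<partial>lborel) \<in> borel_measurable borel"
        by measurable
      have "(\<integral>\<^sup>+y1. \<integral>\<^sup>+w2. f (x1 - y1 * b, w2, b) * (?w b * ennreal (1 / b)) \<partial>lborel \<partial>lborel) =
        (\<integral>\<^sup>+w1. \<integral>\<^sup>+w2. ennreal (1 / b) * (f (w1, w2, b) * (?w b * ennreal (1 / b))) \<partial>lborel \<partial>lborel)"
        unfolding nn_integral_reflect_scale[OF m True]
        by (subst nn_integral_cmult[symmetric], measurable)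
           (intro nn_integral_cong, subst nn_integral_cmult[symmetric], measurable)
      with True show ?thesis
        by (simp add: e[symmetric] ac_simps)
    qed simp
  qed
  also have "\<dots> = (\<integral>\<^sup>+w1. \<integral>\<^sup>+b. \<integral>\<^sup>+w2. f (w1, w2, b) * (indicator {0<..} b * ennreal (1 / b ^ 3))
        \<partial>lborel \<partial>lborel \<partial>lborel)"
    by (rule nn_integral_swap) (simp add: borel_prod[symmetric])
  also have "\<dots> = (\<integral>\<^sup>+w1. \<integral>\<^sup>+w2. \<integral>\<^sup>+b. f (w1, w2, b) * (indicator {0<..} b * ennreal (1 / b ^ 3))
        \<partial>lborel \<partial>lborel \<partial>lborel)"
    by (rule nn_integral_cong, rule nn_integral_swap) (simp add: borel_prod[symmetric])
  also have "\<dots> = (\<integral>\<^sup>+w1. \<integral>\<^sup>+w2. \<integral>\<^sup>+b. f (w1, w2, b) * (indicator G (w1, w2, b) * ennreal (1 / b ^ 3))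
        \<partial>lborel \<partial>lborel \<partial>lborel)"
    by (intro nn_integral_cong) (auto simp: G_def split: split_indicator)
  also have "\<dots> = (\<integral>\<^sup>+z. f z * (indicator G z * ennreal (1 / snd (snd z) ^ 3)) \<partial>lborel)"
    by (subst nn_integral_triple) simp_all
  finally show ?thesis .
qed

lemma integral_rho_reflection:
  fixes f :: "point \<Rightarrow> complex"
  assumes f [measurable]: "f \<in> borel_measurable borel" and x: "x \<in> G"
  shows "(LINT y|rho. f (g_mult x (g_inv y))) =
    (LINT z|lborel. (indicator G z / snd (snd z) ^ 3) *\<^sub>R f z)"
proof -
  let ?T = "\<lambda>y. g_mult x (g_inv y)"
  let ?w = "\<lambda>z::point. indicator G z / snd (snd z) ^ 3 :: real"
  have T: "?T \<in> measurable rho borel" by (intro measurable_rho) simp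
  have wm [measurable]: "?w \<in> borel_measurable lborel" by measurable
  have w: "indicator G z * ennreal (1 / snd (snd z) ^ 3) = ennreal (?w z)" for z :: point
    by (auto split: split_indicator)
  have "distr rho borel ?T = density lborel ?w"
  proof (rule measure_eqI)
    fix A assume "A \<in> sets (distr rho borel ?T)"
    then have [measurable]: "A \<in> sets borel" by simp
    have "emeasure (distr rho borel ?T) A = (\<integral>\<^sup>+z. indicator A z \<partial>distr rho borel ?T)" by simp
    also have "\<dots> = (\<integral>\<^sup>+y. indicator A (?T y) \<partial>rho)"
      by (rule nn_integral_distr[OF T]) simp
    also have "\<dots> = (\<integral>\<^sup>+z. indicator A z * ennreal (?w z) \<partial>lborel)"
      by (subst nn_integral_rho_reflection[OF _ x]) (simp_all add: w)
    also have "\<dots> = emeasure (density lborel ?w) A"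
      by (subst emeasure_density) (simp_all add: mult.commute)
    finally show "emeasure (distr rho borel ?T) A = emeasure (density lborel ?w) A" .
  qed simp
  then have "(LINT z|distr rho borel ?T. f z) = (LINT z|density lborel ?w. f z)" by simp
  moreover have "(LINT z|density lborel ?w. f z) = (LINT z|lborel. ?w z *\<^sub>R f z)"
    by (rule integral_density) (auto simp: G_def split: split_indicator)
  ultimately show ?thesis
    by (simp add: integral_distr[OF T f])
qed

lemma nn_integral_inverse_near_0:
  assumes "0 < e"
  shows "(\<integral>\<^sup>+a. indicator {0<..<e} a * ennreal (1 / a) \<partial>lborel) = \<infinity>"
proof (rule ccontr)
  assume "\<not> ?thesis"
  then obtain n :: nat where n: "(\<integral>\<^sup>+a. indicator {0<..<e} a * ennreal (1 / a) \<partial>lborel) < of_nat n"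
    using ennreal_Ex_less_of_nat by (auto simp: top.not_eq_extremum)
  \<comment> \<open>chosen so that \<open>1 / a\<close> has integral \<open>n\<close> over \<open>[?l, e / 2]\<close>\<close>
  let ?l = "e / 2 * exp (- real n)"
  have l: "0 < ?l" "?l \<le> e / 2" using assms by auto
  have "(\<integral>\<^sup>+a. ennreal (1 / a) * indicator {?l..e / 2} a \<partial>lborel) = ennreal (ln (e / 2) - ln ?l)"
    using l by (intro nn_integral_FTC_Icc) (auto intro!: derivative_eq_intros simp: field_simps)
  also have "ln ?l = ln (e / 2) + ln (exp (- real n))"
    using assms by (subst ln_mult) auto
  also have "ln (e / 2) - (ln (e / 2) + ln (exp (- real n))) = real n"
    by simp
  finally have "ennreal (real n) = (\<integral>\<^sup>+a. ennreal (1 / a) * indicator {?l..e / 2} a \<partial>lborel)"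
    by (rule sym)
  also have "\<dots> \<le> (\<integral>\<^sup>+a. indicator {0<..<e} a * ennreal (1 / a) \<partial>lborel)"
  proof (rule nn_integral_mono)
    fix a :: real
    show "ennreal (1 / a) * indicator {?l..e / 2} a \<le> indicator {0<..<e} a * ennreal (1 / a)"
    proof (cases "a \<in> {?l..e / 2}")
      case True
      then have "0 < a" "a < e" using l(1) assms by (linarith | simp)+
      then show ?thesis by (simp split: split_indicator)
    qed simp
  qed
  finally have "ennreal (real n) \<le> (\<integral>\<^sup>+a. indicator {0<..<e} a * ennreal (1 / a) \<partial>lborel)" .
  with n show False by (simp add: ennreal_of_nat_eq_real_of_nat)
qed

text \<open>
  A box that reaches down to height \<open>0\<close> has infinite measure, since \<open>1 / a\<close> is not integrable
  near \<open>0\<close>.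
\<close>

lemma not_integrable_rho_near_boundary:
  fixes f :: "point \<Rightarrow> complex"
  assumes "0 < e" "0 < c"
    and lower: "\<And>x1 x2 a. \<bar>x1\<bar> < e \<Longrightarrow> \<bar>x2\<bar> < e \<Longrightarrow> 0 < a \<Longrightarrow> a < e \<Longrightarrow> c \<le> cmod (f (x1, x2, a))"
  shows "\<not> integrable rho f"
proof
  assume f: "integrable rho f"
  let ?S = "{-e<..<e} \<times> {-e<..<e} \<times> {0<..<e}"
  have S [measurable]: "?S \<in> sets (borel :: point measure)"
    by (intro borel_open open_Times) auto
  have "(\<integral>\<^sup>+z. ennreal c * indicator ?S z \<partial>rho) = \<infinity>"
  proof -
    let ?I = "{-e<..<e}"
    have m: "(\<lambda>z. ennreal c * indicator ?S z) \<in> borel_measurable borel"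
      "(\<lambda>z. ennreal c * indicator ?S z * (indicator G z * ennreal (1 / snd (snd z)))) \<in> borel_measurable borel"
      by measurable
    have vol: "emeasure lborel ?I = ennreal (2 * e)"
      using assms(1) by simp
    have "(\<integral>\<^sup>+z. ennreal c * indicator ?S z \<partial>rho) =
      (\<integral>\<^sup>+x1. \<integral>\<^sup>+x2. \<integral>\<^sup>+a. ennreal c * indicator ?S (x1, x2, a) * (indicator G (x1, x2, a) * ennreal (1 / a))
        \<partial>lborel \<partial>lborel \<partial>lborel)"
      unfolding nn_integral_rho[OF m(1)] nn_integral_triple[OF m(2)] by (simp only: snd_conv)
    also have "\<dots> = (\<integral>\<^sup>+x1. \<integral>\<^sup>+x2. \<integral>\<^sup>+a. (ennreal c * indicator ?I x1 * indicator ?I x2) *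
        (indicator {0<..<e} a * ennreal (1 / a)) \<partial>lborel \<partial>lborel \<partial>lborel)"
      by (intro nn_integral_cong) (simp add: G_def indicator_def)
    also have "\<dots> = (\<integral>\<^sup>+x1. \<integral>\<^sup>+x2. (ennreal c * indicator ?I x1 * indicator ?I x2) * \<infinity> \<partial>lborel \<partial>lborel)"
    proof (rule nn_integral_cong, rule nn_integral_cong)
      fix x1 x2 :: real
      have "(\<lambda>a. indicator {0<..<e} a * ennreal (1 / a)) \<in> borel_measurable lborel"
        by measurable
      then show "(\<integral>\<^sup>+a. (ennreal c * indicator ?I x1 * indicator ?I x2) * (indicator {0<..<e} a * ennreal (1 / a)) \<partial>lborel) =
          (ennreal c * indicator ?I x1 * indicator ?I x2) * \<infinity>"
        by (subst nn_integral_cmult) (simp_all only: nn_integral_inverse_near_0[OF assms(1)])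
    qed
    also have "\<dots> = (\<integral>\<^sup>+x1. \<integral>\<^sup>+x2. (ennreal c * indicator ?I x1 * \<infinity>) * indicator ?I x2 \<partial>lborel \<partial>lborel)"
      by (simp only: ac_simps)
    also have "\<dots> = (\<integral>\<^sup>+x1. (ennreal c * indicator ?I x1 * \<infinity>) * ennreal (2 * e) \<partial>lborel)"
      by (subst nn_integral_cmult_indicator) (simp_all only: vol, simp)
    also have "\<dots> = (\<integral>\<^sup>+x1. (ennreal c * \<infinity> * ennreal (2 * e)) * indicator ?I x1 \<partial>lborel)"
      by (simp only: ac_simps)
    also have "\<dots> = ennreal c * \<infinity> * ennreal (2 * e) * ennreal (2 * e)"
      by (subst nn_integral_cmult_indicator) (simp_all only: vol, simp)
    also have "\<dots> = \<infinity>"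
      using assms(1,2) by (simp add: ennreal_mult_eq_top_iff)
    finally show ?thesis .
  qed
  moreover have "(\<integral>\<^sup>+z. ennreal c * indicator ?S z \<partial>rho) \<le> (\<integral>\<^sup>+z. ennreal (cmod (f z)) \<partial>rho)"
  proof (rule nn_integral_mono)
    fix z
    show "ennreal c * indicator ?S z \<le> ennreal (cmod (f z))"
    proof (cases "z \<in> ?S")
      case True
      then have "c \<le> cmod (f z)" using lower[of "fst z" "fst (snd z)" "snd (snd z)"] by auto
      then show ?thesis using True by (simp add: ennreal_leI)
    qed simp
  qed
  moreover have "(\<integral>\<^sup>+z. ennreal (cmod (f z)) \<partial>rho) < \<infinity>"
    using f by (simp add: integrable_iff_bounded)
  ultimately show False by (metis leD)
qed

section \<open>The kernel of the inverse Laplacian and its boundary values\<close>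

text \<open>
  The kernel of \<open>\<Delta>\<^sup>-\<^sup>1\<close> with respect to \<open>\<rho>\<close>, that is
  \<open>\<delta>\<^sup>1\<^sup>/\<^sup>2(x) \<delta>\<^sup>1\<^sup>/\<^sup>2(z) / (4 \<pi> sinh d(x, z))\<close>.  For \<open>x = (x\<^sub>1, x\<^sub>2, a)\<close> and \<open>z = (w\<^sub>1, w\<^sub>2, b)\<close> with Euclidean
  horizontal distance \<open>s\<close>, \<open>cosh d(x, z) = (a\<^sup>2 + b\<^sup>2 + s\<^sup>2) / (2 a b)\<close>, so the factors \<open>a b\<close> cancel and
  the formula makes sense, and stays positive, at \<open>a = 0\<close>.
\<close>

definition green :: "point \<Rightarrow> point \<Rightarrow> real" where
  "green x z = 1 / (2 * pi * sqrt
     (((snd (snd x) - snd (snd z))\<^sup>2 + ((fst x - fst z)\<^sup>2 + (fst (snd x) - fst (snd z))\<^sup>2)) *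
      ((snd (snd x) + snd (snd z))\<^sup>2 + ((fst x - fst z)\<^sup>2 + (fst (snd x) - fst (snd z))\<^sup>2))))"

lemma green_measurable [measurable]: "green x \<in> borel_measurable borel"
  unfolding green_def by measurable

text \<open>
  The factor \<open>b\<^sup>2\<close> at height \<open>b\<close> will cancel the density \<open>b\<^sup>-\<^sup>2\<close> of the left Haar measure with
  respect to \<open>\<rho>\<close>.
\<close>

lemma W_eq_green:
  assumes x: "x \<in> G" and y: "y \<in> G" and z: "z = g_mult x (g_inv y)"
  shows "W y = (snd (snd z))\<^sup>2 * green x z"
proof -
  obtain x1 x2 a where xa: "x = (x1, x2, a)" "0 < a" using x by (auto simp: G_def)
  obtain y1 y2 c where yc: "y = (y1, y2, c)" "0 < c" using y by (auto simp: G_def)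
  have z': "z = (x1 - a * y1 / c, x2 - a * y2 / c, a / c)"
    by (simp add: z xa yc g_mult_def g_inv_def)
  define s where "s = y1\<^sup>2 + y2\<^sup>2"
  define M where "M = (c + 1 / c + s / c) / 2"
  have cosh: "cosh (r_dist y) = M" and nn: "0 \<le> r_dist y"
    using r_dist_properties[OF yc(2), of y1 y2] by (simp_all add: yc(1) M_def s_def)
  have sinh: "sinh (r_dist y) = sqrt (M\<^sup>2 - 1)"
  proof -
    have "sqrt ((sinh (r_dist y))\<^sup>2) = sinh (r_dist y)"
      using nn by (simp add: sinh_real_nonneg_iff)
    then show ?thesis by (simp add: sinh_square_eq cosh)
  qed
  have modular: "sqrt (modular y) = 1 / c"
    using yc(2) by (simp add: yc(1) modular_def powr_minus powr_numeral real_sqrt_divide inverse_eq_divide)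
  have "((a - a / c)\<^sup>2 + ((a * y1 / c)\<^sup>2 + (a * y2 / c)\<^sup>2)) * ((a + a / c)\<^sup>2 + ((a * y1 / c)\<^sup>2 + (a * y2 / c)\<^sup>2))
     = (2 * a\<^sup>2 / c)\<^sup>2 * (M\<^sup>2 - 1)"
    using yc(2) unfolding M_def s_def by (simp add: field_simps power2_eq_square)
  then have green: "green x z = 1 / (2 * pi * ((2 * a\<^sup>2 / c) * sqrt (M\<^sup>2 - 1)))"
    using xa(2) yc(2) by (simp add: green_def xa(1) z' real_sqrt_mult)
  have height: "snd (snd z) = a / c" by (simp add: z')
  show ?thesis
    using xa(2) yc(2) unfolding W_def sinh modular green height
    by (simp add: field_simps power2_eq_square)
qed

lemma Laplacian_inverse_eq:
  fixes F :: "point \<Rightarrow> complex"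
  assumes F [measurable]: "F \<in> borel_measurable borel" and supp: "\<And>z. z \<notin> G \<Longrightarrow> F z = 0"
    and x: "x \<in> G"
  shows "Laplacian_inverse F x = (LINT z|lborel. F z * of_real (green x z / snd (snd z)))"
proof -
  let ?f = "\<lambda>z. F z * of_real ((snd (snd z))\<^sup>2 * green x z)"
  have "Laplacian_inverse F x = (LINT y|rho. ?f (g_mult x (g_inv y)))"
    unfolding Laplacian_inverse_def conv_def
    by (intro Bochner_Integration.integral_cong refl) (simp add: W_eq_green[OF x _ refl])
  also have "\<dots> = (LINT z|lborel. (indicator G z / snd (snd z) ^ 3) *\<^sub>R ?f z)"
    by (rule integral_rho_reflection[OF _ x]) measurable
  also have "\<dots> = (LINT z|lborel. F z * of_real (green x z / snd (snd z)))"
  proof (intro Bochner_Integration.integral_cong refl)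
    fix z :: point
    show "(indicator G z / snd (snd z) ^ 3) *\<^sub>R ?f z = F z * of_real (green x z / snd (snd z))"
    proof (cases "z \<in> G")
      case True
      then have "snd (snd z) \<noteq> 0" by (auto simp: G_def)
      then show ?thesis using True
        by (simp add: scaleR_conv_of_real power2_eq_square power3_eq_cube)
    qed (simp add: supp)
  qed
  finally show ?thesis .
qed

text \<open>
  The supports in question stay above height \<open>m\<close>, so the singularity \<open>x = z\<close> is not met while \<open>x\<close>
  has height at most \<open>m\<close>, and the integral is continuous up to and including height \<open>0\<close>.
\<close>

lemma green_integral_continuous:
  fixes F :: "point \<Rightarrow> complex"
  assumes F: "continuous_on UNIV F" "\<And>z. z \<notin> cbox a b \<Longrightarrow> F z = 0"
    and low: "\<And>z. z \<in> cbox a b \<Longrightarrow> m < snd (snd z)" and m: "0 \<le> m"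
  shows "continuous_on {x. 0 \<le> snd (snd x) \<and> snd (snd x) \<le> m}
    (\<lambda>x. LINT z|lborel. F z * of_real (green x z / snd (snd z)))"
proof -
  let ?U = "{x::point. 0 \<le> snd (snd x) \<and> snd (snd x) \<le> m}"
  have cont: "continuous_on (?U \<times> cbox a b) (\<lambda>p. F (snd p) * of_real (green (fst p) (snd p) / snd (snd (snd p))))"
  proof (intro continuous_on_mult continuous_on_of_real)
    show "continuous_on (?U \<times> cbox a b) (\<lambda>p. F (snd p))"
      by (rule continuous_on_compose2[OF F(1)]) (auto intro: continuous_on_snd continuous_on_id)
    let ?w = "\<lambda>p::point \<times> point. (fst (fst p) - fst (snd p))\<^sup>2 + (fst (snd (fst p)) - fst (snd (snd p)))\<^sup>2"
    let ?h = "\<lambda>p. snd (snd (fst p))" and ?k = "\<lambda>p. snd (snd (snd p))"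
    have pos: "0 < ?k p" "0 < ((?h p - ?k p)\<^sup>2 + ?w p) * ((?h p + ?k p)\<^sup>2 + ?w p)"
      if "p \<in> ?U \<times> cbox a b" for p
    proof -
      have "?h p < ?k p" "0 \<le> ?h p" "m < ?k p"
        using that low[of "snd p"] by (auto simp: mem_Times_iff)
      moreover from this m show "0 < ?k p" by simp
      ultimately show "0 < ((?h p - ?k p)\<^sup>2 + ?w p) * ((?h p + ?k p)\<^sup>2 + ?w p)"
        by (intro mult_pos_pos add_pos_nonneg) simp_all
    qed
    have scale: "2 * pi * t \<noteq> 0" if "0 < t" for t :: real using that by simp
    have "continuous_on (?U \<times> cbox a b) (\<lambda>p. 1 / (2 * pi * sqrt (((?h p - ?k p)\<^sup>2 + ?w p) * ((?h p + ?k p)\<^sup>2 + ?w p))) / ?k p)"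
    proof (rule continuous_on_divide[OF continuous_on_divide])
      show "\<forall>p\<in>?U \<times> cbox a b. ?k p \<noteq> 0"
      proof
        fix p assume "p \<in> ?U \<times> cbox a b"
        then have "0 < ?k p" by (rule pos(1))
        then show "?k p \<noteq> 0" by simp
      qed
      show "\<forall>p\<in>?U \<times> cbox a b. 2 * pi * sqrt (((?h p - ?k p)\<^sup>2 + ?w p) * ((?h p + ?k p)\<^sup>2 + ?w p)) \<noteq> 0"
      proof
        fix p assume "p \<in> ?U \<times> cbox a b"
        then have "0 < sqrt (((?h p - ?k p)\<^sup>2 + ?w p) * ((?h p + ?k p)\<^sup>2 + ?w p))"
          by (intro real_sqrt_gt_zero pos(2))
        then show "2 * pi * sqrt (((?h p - ?k p)\<^sup>2 + ?w p) * ((?h p + ?k p)\<^sup>2 + ?w p)) \<noteq> 0"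
          by (rule scale)
      qed
    qed (intro continuous_intros)+
    then show "continuous_on (?U \<times> cbox a b) (\<lambda>p. green (fst p) (snd p) / ?k p)"
      by (simp only: green_def)
  qed
  then have "continuous_on ?U (\<lambda>x. integral (cbox a b) (\<lambda>z. F z * of_real (green x z / snd (snd z))))"
    by (intro integral_continuous_on_param) (simp only: case_prod_unfold)
  moreover have "integral (cbox a b) (\<lambda>z. F z * of_real (green x z / snd (snd z))) =
      (LINT z|lborel. F z * of_real (green x z / snd (snd z)))" if "x \<in> ?U" for x
  proof (rule compact_support_integral(2)[symmetric])
    have "continuous_on (cbox a b) (\<lambda>z. F (snd (x, z)) *
        of_real (green (fst (x, z)) (snd (x, z)) / snd (snd (snd (x, z)))))"
      by (rule continuous_on_compose2[OF cont]) (use that in \<open>auto intro!: continuous_intros\<close>)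
    then show "continuous_on (cbox a b) (\<lambda>z. F z * of_real (green x z / snd (snd z)))"
      by (simp only: fst_conv snd_conv)
  qed (simp add: F(2))
  ultimately show ?thesis
    by (rule continuous_on_eq)
qed

text \<open>
  This is \<open>\<partial>\<^sub>j (b \<partial>\<^sub>i P)\<close> for \<open>P z = 1 / (2 \<pi> \<bar>z\<bar>\<^sup>2)\<close>, where \<open>b\<close> is the height of \<open>z\<close> and \<open>P = green 0\<close> is
  the kernel at the boundary point \<open>0\<close>.  Writing coordinates as inner products with \<open>coord_dir\<close> keeps
  one formula for all \<open>i\<close> and \<open>j\<close>.
\<close>

definition boundary_kernel :: "nat \<Rightarrow> nat \<Rightarrow> point \<Rightarrow> real" where
  "boundary_kernel i j z = (4 * (z \<bullet> coord_dir 0) * (z \<bullet> coord_dir i) * (z \<bullet> coord_dir j) / (z \<bullet> z) ^ 3 -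
     ((coord_dir j \<bullet> coord_dir 0) * (z \<bullet> coord_dir i) + (z \<bullet> coord_dir 0) * (coord_dir j \<bullet> coord_dir i))
       / (z \<bullet> z) ^ 2) / pi"

lemma inner_coord_dir_0: "z \<bullet> coord_dir 0 = snd (snd z)"
  by (cases z) (simp add: coord_dir_def)

lemma green_origin: "green 0 z = 1 / (2 * pi * (z \<bullet> z))"
proof -
  obtain w1 w2 b where z: "z = (w1, w2, b)" by (cases z)
  have "green 0 z = 1 / (2 * pi * sqrt ((z \<bullet> z)\<^sup>2))"
    unfolding green_def z by (simp add: power2_eq_square algebra_simps)
  then show ?thesis by simp
qed

lemma X_eq: "X i f z = of_real (z \<bullet> coord_dir 0) * frechet_derivative f (at z) (coord_dir i)"
  by (cases z) (simp add: X_def inner_coord_dir_0)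

lemma inner_self_has_derivative:
  "((\<lambda>z::'a::real_inner. z \<bullet> z) has_derivative (\<lambda>v. 2 * (z \<bullet> v))) (at z)"
  by (rule derivative_eq_intros refl)+ (simp add: fun_eq_iff inner_commute)

text \<open>
  The next two lemmas are the two derivatives behind \<open>boundary_kernel\<close>: first of \<open>P\<close>, then of
  \<open>b \<partial>\<^sub>i P\<close>, stated for arbitrary directions in an inner product space.
\<close>

lemma inverse_square_has_derivative:
  fixes z :: "'a::real_inner"
  assumes "z \<noteq> 0"
  shows "((\<lambda>z. 1 / (2 * pi * (z \<bullet> z))) has_derivative (\<lambda>v. - (z \<bullet> v) / (pi * (z \<bullet> z)\<^sup>2))) (at z)"
proof (rule has_derivative_eq_rhs)
  have "z \<bullet> z \<noteq> 0" using assms by simp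
  then have "((\<lambda>t. 1 / (2 * pi * t)) has_real_derivative - 1 / (2 * pi * (z \<bullet> z)\<^sup>2)) (at (z \<bullet> z))"
    by (auto intro!: derivative_eq_intros simp: field_simps power2_eq_square)
  then have "((\<lambda>t. 1 / (2 * pi * t)) has_derivative (*) (- 1 / (2 * pi * (z \<bullet> z)\<^sup>2))) (at (z \<bullet> z))"
    by (simp only: has_field_derivative_def)
  from has_derivative_compose[OF inner_self_has_derivative this]
  show "((\<lambda>z. 1 / (2 * pi * (z \<bullet> z))) has_derivative
      (\<lambda>v. - 1 / (2 * pi * (z \<bullet> z)\<^sup>2) * (2 * (z \<bullet> v)))) (at z)" .
qed (simp add: fun_eq_iff)

lemma inverse_square_has_second_derivative:
  fixes z :: "'a::real_inner"
  assumes "z \<noteq> 0"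
  shows "((\<lambda>z. (z \<bullet> a) * (- (z \<bullet> b) / (pi * (z \<bullet> z)\<^sup>2))) has_derivative
     (\<lambda>v. (4 * (z \<bullet> a) * (z \<bullet> b) * (z \<bullet> v) / (z \<bullet> z) ^ 3 -
       ((v \<bullet> a) * (z \<bullet> b) + (z \<bullet> a) * (v \<bullet> b)) / (z \<bullet> z)\<^sup>2) / pi)) (at z)"
proof -
  have n: "z \<bullet> z \<noteq> 0" using assms by simp
  then have "((\<lambda>t. 1 / (pi * t\<^sup>2)) has_real_derivative - 2 / (pi * (z \<bullet> z) ^ 3)) (at (z \<bullet> z))"
    by (auto intro!: derivative_eq_intros simp: field_simps power2_eq_square power3_eq_cube)
  then have "((\<lambda>t. 1 / (pi * t\<^sup>2)) has_derivative (*) (- 2 / (pi * (z \<bullet> z) ^ 3))) (at (z \<bullet> z))"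
    by (simp only: has_field_derivative_def)
  note k = has_derivative_compose[OF inner_self_has_derivative this]
  have g: "((\<lambda>z. - ((z \<bullet> a) * (z \<bullet> b))) has_derivative
      (\<lambda>v. - ((z \<bullet> a) * (v \<bullet> b) + (v \<bullet> a) * (z \<bullet> b)))) (at z)"
    by (rule derivative_eq_intros refl)+
  have eq: "(\<lambda>z. (z \<bullet> a) * (- (z \<bullet> b) / (pi * (z \<bullet> z)\<^sup>2))) =
      (\<lambda>z. - ((z \<bullet> a) * (z \<bullet> b)) * (1 / (pi * (z \<bullet> z)\<^sup>2)))"
    by (simp add: fun_eq_iff)
  have alg: "- (x * y) * (- 2 / (pi * t ^ 3) * (2 * w)) + - (x * y' + x' * y) * (1 / (pi * t\<^sup>2)) =
      (4 * x * y * w / t ^ 3 - (x' * y + x * y') / t\<^sup>2) / pi" for x y x' y' t w :: real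
    by (simp add: diff_divide_distrib add_divide_distrib algebra_simps)
  show ?thesis
    unfolding eq
    by (rule has_derivative_eq_rhs[OF has_derivative_mult[OF g k]]) (simp only: alg)
qed

text \<open>
  The left side is the value at the boundary point \<open>0\<close> of the continuous extension of \<open>S\<^sub>i\<^sub>j f\<close>.  Since
  \<open>X\<^sub>i = b \<partial>\<^sub>i\<close> and \<open>d\<rho> = dz / b\<close>, the weight cancels in the first integration by parts and a factor \<open>b\<close>
  is left for the second.
\<close>

lemma Riesz2_boundary_value:
  assumes f: "f \<in> bumps K" and K: "compact K" "K \<subseteq> G"
  shows "(LINT z|lborel. X i (X j f) z * of_real (green 0 z / snd (snd z))) =
    (LINT z|lborel. f z * of_real (boundary_kernel i j z))"
proof -
  let ?e = "coord_dir"
  let ?n = "\<lambda>z::point. z \<bullet> z"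
  let ?D = "\<lambda>z v. - (z \<bullet> v) / (pi * (?n z)\<^sup>2)"
  let ?P = "\<lambda>z. (z \<bullet> ?e 0) * ?D z (?e i)"
  let ?D' = "\<lambda>z v. (4 * (z \<bullet> ?e 0) * (z \<bullet> ?e i) * (z \<bullet> v) / ?n z ^ 3 -
     ((v \<bullet> ?e 0) * (z \<bullet> ?e i) + (z \<bullet> ?e 0) * (v \<bullet> ?e i)) / ?n z ^ 2) / pi"
  have U: "open (- {0::point})" "K \<subseteq> - {0}"
    using K(2) by (auto simp: G_def zero_prod_def)
  note h = bumps_X[OF f, of j]
  have D1: "((\<lambda>z. complex_of_real (green 0 z)) has_derivative (\<lambda>v. of_real (?D z v))) (at z)"
    if "z \<in> - {0}" for z
    unfolding green_origin using that
    by (intro has_derivative_of_real inverse_square_has_derivative) simp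
  have D2: "((\<lambda>z. complex_of_real (?P z)) has_derivative (\<lambda>v. of_real (?D' z v))) (at z)"
    if "z \<in> - {0}" for z
    using that by (intro has_derivative_of_real inverse_square_has_second_derivative) simp
  have C1: "continuous_on (- {0}) (\<lambda>z. complex_of_real (?D z v))" for v
    by (intro continuous_on_of_real continuous_intros) simp
  have C2: "continuous_on (- {0}) (\<lambda>z. complex_of_real (?D' z v))" for v
    by (intro continuous_on_of_real continuous_intros) simp_all
  have "(LINT z|lborel. X i (X j f) z * of_real (green 0 z / snd (snd z))) =
      (LINT z|lborel. frechet_derivative (X j f) (at z) (?e i) * of_real (green 0 z))"
  proof (intro Bochner_Integration.integral_cong refl)
    fix z
    show "X i (X j f) z * of_real (green 0 z / snd (snd z)) =
        frechet_derivative (X j f) (at z) (?e i) * of_real (green 0 z)"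
    proof (cases "z \<in> K")
      case True
      then have "snd (snd z) \<noteq> 0" using K(2) by (auto simp: G_def)
      then show ?thesis by (simp add: X_eq[of i] inner_coord_dir_0)
    next
      case False
      with bumps_zero_outside[OF bumps_frechet_derivative[OF h]] show ?thesis by (simp add: X_eq[of i])
    qed
  qed
  also have "\<dots> = - (LINT z|lborel. X j f z * of_real (?D z (?e i)))"
    by (rule bumps_integration_by_parts[OF h K(1) U D1 C1]) simp
  also have "\<dots> = - (LINT z|lborel. frechet_derivative f (at z) (?e j) * of_real (?P z))"
    by (simp add: X_eq[of j] mult_ac)
  also have "\<dots> = (LINT z|lborel. f z * of_real (?D' z (?e j)))"
    by (subst bumps_integration_by_parts[OF f K(1) U D2 C2]) simp_all
  finally show ?thesis by (simp add: boundary_kernel_def)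
qed

text \<open>
  Up to the factor \<open>1 / \<pi>\<close> the values are \<open>4 / 27 - (\<delta>\<^sub>0\<^sub>j + \<delta>\<^sub>i\<^sub>j) / 9\<close> at \<open>(1, 1, 1)\<close> and
  \<open>3 \<delta>\<^sub>0\<^sub>i \<delta>\<^sub>0\<^sub>j - \<delta>\<^sub>i\<^sub>j\<close> at \<open>(0, 0, 1)\<close>.  These two points have the same height, so that bumps around
  them are horizontal translates of each other.
\<close>

lemma boundary_kernel_distinguishes:
  assumes "i \<in> {0, 1, 2}" "j \<in> {0, 1, 2}"
  shows "boundary_kernel i j (1, 1, 1) \<noteq> boundary_kernel i j (0, 0, 1)"
  using assms by (auto simp: boundary_kernel_def coord_dir_def)

lemma boundary_kernel_continuous: "continuous_on (- {0}) (boundary_kernel i j)"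
  unfolding boundary_kernel_def by (intro continuous_intros) auto

section \<open>Differences of two translated bumps\<close>

definition bump :: "real \<Rightarrow> 'a::real_inner \<Rightarrow> 'a \<Rightarrow> real" where
  "bump r p z = flat_exp 0 (r\<^sup>2 - (z - p) \<bullet> (z - p))"

lemma bump_in_bumps: "0 < r \<Longrightarrow> cball p r \<subseteq> K \<Longrightarrow> (\<lambda>z. of_real (bump r p z)) \<in> bumps K"
  unfolding bump_def by (rule bumps.base)

lemma bump_translate: "bump r p (p + z) = bump r 0 z"
  by (simp add: bump_def)

lemma bump_zero_outside:
  assumes "0 < r" "z \<notin> cball p r"
  shows "bump r p z = 0"
proof -
  have "complex_of_real (bump r p z) = 0"
    by (rule bumps_zero_outside[OF bump_in_bumps[OF assms(1) subset_refl] assms(2)])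
  then show ?thesis by simp
qed

lemma bump_continuous: "continuous_on U (bump r p)"
proof -
  have "continuous_on UNIV (flat_exp 0)"
    by (intro continuous_at_imp_continuous_on ballI DERIV_isCont[OF flat_exp_has_derivative])
  then show ?thesis
    unfolding bump_def by (rule continuous_on_compose2) (intro continuous_intros, simp)
qed

lemma bump_times_integrable:
  fixes p :: "'a::euclidean_space"
  assumes "0 < r" "continuous_on (cball p r) c"
  shows "integrable lborel (\<lambda>z. bump r p z * c z :: real)"
proof -
  have "integrable lborel (\<lambda>z. indicator (cball p r) z *\<^sub>R (bump r p z * c z))"
    by (intro borel_integrable_compact compact_cball continuous_on_mult bump_continuous assms)
  also have "(\<lambda>z. indicator (cball p r) z *\<^sub>R (bump r p z * c z)) = (\<lambda>z. bump r p z * c z)"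
    using bump_zero_outside[OF assms(1)] by (auto simp: fun_eq_iff indicator_def)
  finally show ?thesis .
qed

lemma bump_integral_translate:
  fixes p :: "'a::euclidean_space"
  assumes "0 < r" "continuous_on (cball p r) c"
  shows "(LINT z|lborel. bump r p z * c z) = (LINT z|lborel. bump r 0 z * c (p + z) :: real)"
    and "integrable lborel (\<lambda>z. bump r 0 z * c (p + z))"
proof -
  have m: "(\<lambda>z. bump r p z * c z) \<in> borel_measurable borel"
    using borel_measurable_integrable[OF bump_times_integrable[OF assms]] by simp
  have "(LINT z|lborel. bump r p z * c z) = (LINT z|distr lborel borel ((+) p). bump r p z * c z)"
    by (simp only: lborel_distr_plus)
  also have "\<dots> = (LINT z|lborel. bump r p (p + z) * c (p + z))"
    by (rule integral_distr) (simp_all add: m)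
  finally show "(LINT z|lborel. bump r p z * c z) = (LINT z|lborel. bump r 0 z * c (p + z))"
    by (simp only: bump_translate)
  have "integrable (distr lborel borel ((+) p)) (\<lambda>z. bump r p z * c z)"
    using bump_times_integrable[OF assms] by (simp only: lborel_distr_plus)
  then have "integrable lborel (\<lambda>z. bump r p (p + z) * c (p + z))"
    by (rule integrable_distr[rotated]) simp
  then show "integrable lborel (\<lambda>z. bump r 0 z * c (p + z))"
    by (simp only: bump_translate)
qed

text \<open>
  For a function \<open>c\<close> of the height only and \<open>p\<close>, \<open>q\<close> of equal height the right side vanishes, which
  gives mean zero for \<open>\<rho>\<close>; for \<open>c\<close> with \<open>c p \<noteq> c q\<close> and small \<open>r\<close> it does not vanish.
\<close>

lemma bump_difference_integral:
  fixes p q :: "'a::euclidean_space"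
  assumes "0 < r" "continuous_on (cball p r) c" "continuous_on (cball q r) c"
  shows "(LINT z|lborel. (bump r p z - bump r q z) * c z) =
    (LINT z|lborel. bump r 0 z * (c (p + z) - c (q + z)) :: real)"
  using bump_integral_translate[OF assms(1,2)] bump_integral_translate[OF assms(1,3)]
    bump_times_integrable[OF assms(1,2)] bump_times_integrable[OF assms(1,3)]
  by (simp add: left_diff_distrib right_diff_distrib)

lemma bump_integral_pos:
  fixes r :: real
  assumes "0 < r"
  shows "0 < (LINT z|lborel. bump r (0::'a::euclidean_space) z)"
proof -
  have i: "integrable lborel (bump r (0::'a))"
    using bump_times_integrable[OF assms, of 0 "\<lambda>_. 1"] by simp
  have nn: "0 \<le> bump r (0::'a) z" for z by (simp add: bump_def flat_exp_nonneg)
  have "(LINT z|lborel. bump r (0::'a) z) \<noteq> 0"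
  proof
    assume "(LINT z|lborel. bump r (0::'a) z) = 0"
    then have "AE z in lborel. bump r (0::'a) z = 0"
      using integral_nonneg_eq_0_iff_AE[OF i] nn by simp
    then have "AE z in lborel. z \<notin> ball (0::'a) r"
    proof eventually_elim
      case (elim z)
      show ?case
      proof
        assume "z \<in> ball 0 r"
        then have "(norm z)\<^sup>2 < r\<^sup>2" by (intro power_strict_mono) auto
        with elim show False by (simp add: bump_def flat_exp_def power2_norm_eq_inner)
      qed
    qed
    then have "emeasure lborel (ball (0::'a) r) = 0"
      by (subst (asm) AE_iff_measurable[of "ball 0 r"]) auto
    with assms show False
      using emeasure_ball[of r "0::'a"] unit_ball_vol_pos[of "DIM('a)"]
      by (simp add: ennreal_mult_eq_top_iff)
  qed
  moreover have "0 \<le> (LINT z|lborel. bump r (0::'a) z)" using nn by simp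
  ultimately show ?thesis by simp
qed

text \<open>
  As \<open>r\<close> tends to \<open>0\<close> the integral is \<open>(c p - c q)\<close> times the mass of the bump, up to a smaller
  error.
\<close>

lemma bump_difference_integral_nonzero:
  fixes p q :: "'a::euclidean_space"
  assumes c: "continuous_on U c" "open U" "p \<in> U" "q \<in> U" and neq: "c p \<noteq> (c q :: real)" and R: "0 < R"
  obtains r where "0 < r" "r \<le> R" "(LINT z|lborel. (bump r p z - bump r q z) * c z) \<noteq> 0"
proof -
  define d where "d = c p - c q"
  have "d \<noteq> 0" using neq by (simp add: d_def)
  have "isCont c p" "isCont c q"
    using c by (auto simp: continuous_on_eq_continuous_at)
  then have lim: "((\<lambda>z. c (p + z) - c (q + z)) \<longlongrightarrow> d) (at 0)"
    unfolding d_def by (intro tendsto_diff) (simp_all add: isCont_iff)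
  obtain s where s: "0 < s" "\<And>z. z \<noteq> 0 \<Longrightarrow> norm z < s \<Longrightarrow> \<bar>(c (p + z) - c (q + z)) - d\<bar> < \<bar>d\<bar> / 2"
    using LIM_D[OF lim, of "\<bar>d\<bar> / 2"] \<open>d \<noteq> 0\<close> by auto
  have s': "\<bar>(c (p + z) - c (q + z)) - d\<bar> \<le> \<bar>d\<bar> / 2" if "norm z < s" for z
    using s(2)[of z] that by (cases "z = 0") (auto simp: d_def)
  obtain s1 s2 where s12: "0 < s1" "cball p s1 \<subseteq> U" "0 < s2" "cball q s2 \<subseteq> U"
    using c by (meson open_contains_cball)
  define r where "r = min (min s1 s2) (min R (s / 2))"
  have r: "0 < r" "r \<le> R" "r < s" "r \<le> s1" "r \<le> s2"
    using s(1) s12 R by (auto simp: r_def)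
  have cont: "continuous_on (cball p r) c" "continuous_on (cball q r) c"
    using r s12 by (auto intro!: continuous_on_subset[OF c(1)])
  define M where "M = (LINT z|lborel. bump r (0::'a) z)"
  have M: "0 < M" unfolding M_def by (rule bump_integral_pos[OF r(1)])
  let ?g = "\<lambda>z. c (p + z) - c (q + z)"
  have i1: "integrable lborel (\<lambda>z. bump r 0 z * ?g z)"
    using bump_integral_translate(2)[OF r(1) cont(1)] bump_integral_translate(2)[OF r(1) cont(2)]
    by (simp add: right_diff_distrib)
  have i2: "integrable lborel (bump r (0::'a))"
    using bump_times_integrable[OF r(1), of 0 "\<lambda>_. 1"] by simp
  have "\<bar>(LINT z|lborel. bump r 0 z * ?g z) - M * d\<bar> = \<bar>LINT z|lborel. bump r 0 z * (?g z - d)\<bar>"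
    using i1 i2 by (simp add: right_diff_distrib[of _ _ d] M_def)
  also have "\<dots> \<le> (LINT z|lborel. \<bar>bump r 0 z * (?g z - d)\<bar>)"
    by (rule integral_abs_bound)
  also have "\<dots> \<le> (LINT z::'a|lborel. bump r 0 z * (\<bar>d\<bar> / 2))"
  proof (rule Bochner_Integration.integral_mono)
    show "integrable lborel (\<lambda>z. \<bar>bump r 0 z * (?g z - d)\<bar>)"
      using i1 i2 by (intro integrable_abs) (simp add: right_diff_distrib[of _ _ d])
    show "integrable lborel (\<lambda>z::'a. bump r 0 z * (\<bar>d\<bar> / 2))"
      using i2 by simp
    fix z :: 'a
    have nonneg: "0 \<le> bump r 0 z" by (simp add: bump_def flat_exp_nonneg)
    show "\<bar>bump r 0 z * (?g z - d)\<bar> \<le> bump r 0 z * (\<bar>d\<bar> / 2)"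
    proof (cases "z \<in> cball 0 r")
      case True
      with r(3) s'[of z] have "\<bar>?g z - d\<bar> \<le> \<bar>d\<bar> / 2" by simp
      then show ?thesis
        by (simp only: abs_mult abs_of_nonneg[OF nonneg] mult_left_mono[OF _ nonneg])
    qed (simp add: bump_zero_outside[OF r(1)])
  qed
  also have "\<dots> = M * (\<bar>d\<bar> / 2)" by (simp add: M_def)
  finally have "\<bar>(LINT z|lborel. bump r 0 z * ?g z) - M * d\<bar> \<le> M * (\<bar>d\<bar> / 2)" .
  moreover have "M * (\<bar>d\<bar> / 2) < \<bar>M * d\<bar>"
    using M \<open>d \<noteq> 0\<close> by (simp add: abs_mult)
  ultimately have "(LINT z|lborel. bump r 0 z * ?g z) \<noteq> 0" by auto
  then show thesis
    using that[OF r(1,2)] bump_difference_integral[OF r(1) cont] by simp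
qed

section \<open>Membership in the Hardy space\<close>

lemma bumps_integrable_rho:
  assumes f: "f \<in> bumps K" and K: "compact K" "K \<subseteq> G"
  shows "integrable rho f"
    and "(LINT z|rho. f z) = (LINT z|lborel. of_real (1 / snd (snd z)) * f z)"
proof -
  have eq: "(indicator G z / snd (snd z)) *\<^sub>R f z = of_real (1 / snd (snd z)) * f z" for z
    using bumps_zero_outside[OF f, of z] K(2) by (cases "z \<in> G") (auto simp: scaleR_conv_of_real)
  have m: "f \<in> borel_measurable borel"
    by (intro borel_measurable_continuous_onI bumps_continuous[OF f])
  show "(LINT z|rho. f z) = (LINT z|lborel. of_real (1 / snd (snd z)) * f z)"
    unfolding integral_rho(1)[OF m] eq ..
  have "continuous_on K (\<lambda>z. complex_of_real (1 / snd (snd z)) * f z)"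
    using K(2) by (intro continuous_on_mult continuous_on_of_real continuous_intros bumps_continuous[OF f])
      (auto simp: G_def)
  then have "integrable lborel (\<lambda>z. indicator K z *\<^sub>R (complex_of_real (1 / snd (snd z)) * f z))"
    by (intro borel_integrable_compact K(1))
  also have "(\<lambda>z. indicator K z *\<^sub>R (complex_of_real (1 / snd (snd z)) * f z)) =
      (\<lambda>z. of_real (1 / snd (snd z)) * f z)"
    using bumps_zero_outside[OF f] by (auto simp: fun_eq_iff indicator_def)
  finally show "integrable rho f"
    unfolding integral_rho(2)[OF m] eq .
qed

text \<open>
  The Calderon-Zygmund set with parameters \<open>b\<^sub>1 = b\<^sub>2 = 0\<close>, \<open>a = r = 1\<close> and \<open>L = e\<^sup>2\<close>, the smallest side
  length allowed for \<open>r = 1\<close>.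
\<close>

definition unit_CZ_set :: "point set" where
  "unit_CZ_set = {- (exp 2 / 2)..exp 2 / 2} \<times> {- (exp 2 / 2)..exp 2 / 2} \<times> {exp (- 1)..exp 1}"

lemma unit_CZ_set_is_CZ_set: "CZ_set unit_CZ_set"
  unfolding CZ_set_def unit_CZ_set_def
  by (rule exI[of _ 0], rule exI[of _ 0], rule exI[of _ "exp 2"], rule exI[of _ 1], rule exI[of _ 1]) simp

lemma unit_CZ_set_cbox: "unit_CZ_set = cbox (- (exp 2 / 2), - (exp 2 / 2), exp (- 1)) (exp 2 / 2, exp 2 / 2, exp 1)"
  by (simp add: unit_CZ_set_def cbox_Pair_eq)

lemma measure_unit_CZ_set_pos: "0 < measure rho unit_CZ_set"
proof -
  let ?R = unit_CZ_set
  have [measurable]: "?R \<in> sets borel" by (simp add: unit_CZ_set_cbox)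
  have RG: "?R \<subseteq> G"
    by (auto simp: unit_CZ_set_def G_def intro: less_le_trans[OF exp_gt_zero])
  then have sets: "?R \<in> sets rho"
    by (auto simp: sets_rho sets_restrict_space)
  have "emeasure rho ?R = (\<integral>\<^sup>+z. indicator ?R z \<partial>rho)" using sets by simp
  also have "\<dots> = (\<integral>\<^sup>+z. indicator ?R z * (indicator G z * ennreal (1 / snd (snd z))) \<partial>lborel)"
    by (rule nn_integral_rho) simp
  finally have em: "emeasure rho ?R = (\<integral>\<^sup>+z. indicator ?R z * (indicator G z * ennreal (1 / snd (snd z))) \<partial>lborel)" .
  have bounds: "exp (- 1) \<le> 1 / snd (snd z)" "1 / snd (snd z) \<le> exp 1" if "z \<in> ?R" for z
  proof -
    have b: "exp (- 1) \<le> snd (snd z)" "snd (snd z) \<le> exp 1" using that by (auto simp: unit_CZ_set_def)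
    have "0 < snd (snd z)" using b(1) by (rule less_le_trans[OF exp_gt_zero])
    then show "exp (- 1) \<le> 1 / snd (snd z)" "1 / snd (snd z) \<le> exp 1"
      using b by (simp_all add: exp_minus field_simps)
  qed
  have finite_lborel: "emeasure lborel ?R < \<infinity>"
    unfolding unit_CZ_set_cbox by (rule emeasure_lborel_cbox_finite)
  have pos_lborel: "0 < emeasure lborel ?R"
  proof -
    have "0 < measure lborel ?R"
      unfolding unit_CZ_set_cbox content_Pair by simp
    then have "emeasure lborel ?R \<noteq> 0" by (auto simp: measure_def)
    then show ?thesis by (simp add: zero_less_iff_neq_zero)
  qed
  have "emeasure rho ?R \<le> (\<integral>\<^sup>+z. ennreal (exp 1) * indicator ?R z \<partial>lborel)"
    unfolding em using bounds(2) RG by (intro nn_integral_mono) (auto split: split_indicator intro: ennreal_leI)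
  also have "\<dots> = ennreal (exp 1) * emeasure lborel ?R"
    by (rule nn_integral_cmult_indicator) simp
  also have "\<dots> < \<infinity>"
    using finite_lborel by (simp add: ennreal_mult_less_top)
  finally have fin: "emeasure rho ?R < \<infinity>" .
  have "0 < ennreal (exp (- 1)) * emeasure lborel ?R"
    using pos_lborel by (simp add: ennreal_zero_less_mult_iff)
  also have "\<dots> = (\<integral>\<^sup>+z. ennreal (exp (- 1)) * indicator ?R z \<partial>lborel)"
    by (rule nn_integral_cmult_indicator[symmetric]) simp
  also have "\<dots> \<le> emeasure rho ?R"
    unfolding em using bounds(1) RG by (intro nn_integral_mono) (auto split: split_indicator intro: ennreal_leI)
  finally show ?thesis
    using fin by (simp add: measure_def enn2real_positive_iff)
qed

text \<open>
  A bounded function of mean zero supported in a Calderon-Zygmund set is a multiple of one atom.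
\<close>

lemma bumps_in_H1:
  assumes f: "f \<in> bumps K" and K: "compact K" "K \<subseteq> G" "K \<subseteq> unit_CZ_set"
    and mean: "(LINT z|rho. f z) = 0"
  shows "f \<in> H1"
proof -
  note int = bumps_integrable_rho(1)[OF f K(1,2)]
  have "bounded (f ` K)"
    using K(1) bumps_continuous[OF f] by (intro compact_imp_bounded compact_continuous_image) auto
  then obtain M where M: "0 < M" "\<And>z. z \<in> K \<Longrightarrow> cmod (f z) \<le> M"
    by (auto simp: bounded_pos)
  have bound: "cmod (f z) \<le> M" for z
    using M bumps_zero_outside[OF f, of z] by (cases "z \<in> K") auto
  define \<mu> where "\<mu> = M * measure rho unit_CZ_set"
  have \<mu>: "0 < \<mu>" unfolding \<mu>_def by (intro mult_pos_pos M measure_unit_CZ_set_pos)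
  define A where "A z = f z / of_real \<mu>" for z
  have "atom A"
    unfolding atom_def
  proof (intro conjI exI[of _ unit_CZ_set])
    show "integrable rho A" unfolding A_def using int by simp
    show "CZ_set unit_CZ_set" by (rule unit_CZ_set_is_CZ_set)
    show "AE z in rho. z \<notin> unit_CZ_set \<longrightarrow> A z = 0"
      using bumps_zero_outside[OF f] K(3) by (intro AE_I2) (auto simp: A_def)
    have "cmod (A z) \<le> 1 / measure rho unit_CZ_set" for z
    proof -
      have "cmod (A z) = cmod (f z) / \<mu>" using \<mu> by (simp add: A_def norm_divide)
      also have "\<dots> \<le> M / \<mu>" using bound \<mu> by (intro divide_right_mono) auto
      also have "\<dots> = 1 / measure rho unit_CZ_set" using M(1) by (simp add: \<mu>_def)
      finally show ?thesis .
    qed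
    then show "AE z in rho. cmod (A z) \<le> 1 / measure rho unit_CZ_set" by simp
    show "(LINT z|rho. A z) = 0" unfolding A_def using mean by simp
  qed
  let ?c = "\<lambda>j::nat. if j = 0 then complex_of_real \<mu> else 0"
  have sum: "(\<Sum>j<n. ?c j * A z) = f z" if "0 < n" for n z
  proof -
    have "(\<Sum>j<n. ?c j * A z) = (\<Sum>j<n. if j = 0 then of_real \<mu> * A z else 0)"
      by (intro sum.cong) auto
    also have "\<dots> = of_real \<mu> * A z" using that by (simp add: sum.delta)
    finally show ?thesis using \<mu> by (simp add: A_def)
  qed
  have "atomic_decomposition f ?c (\<lambda>_. A)"
    unfolding atomic_decomposition_def
  proof (intro conjI allI)
    show "atom A" by fact
    show "summable (\<lambda>j. cmod (?c j))" by (rule summable_finite[of "{0}"]) auto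
    have "\<forall>\<^sub>F n in sequentially. L1_norm (\<lambda>z. f z - (\<Sum>j<n. ?c j * A z)) = 0"
      using eventually_gt_at_top[of 0] by eventually_elim (simp only: sum, simp add: L1_norm_def)
    then show "(\<lambda>n. L1_norm (\<lambda>z. f z - (\<Sum>j<n. ?c j * A z))) \<longlonglongrightarrow> 0"
      by (rule tendsto_eventually)
  qed
  with int show ?thesis unfolding H1_def by blast
qed

section \<open>Unboundedness of the second-order Riesz transforms\<close>

text \<open>
  A nonzero boundary value at \<open>0\<close> keeps \<open>\<bar>S\<^sub>i\<^sub>j f\<bar>\<close> away from \<open>0\<close> on a box next to \<open>0\<close>, whose measure
  is infinite.
\<close>

lemma Riesz2_not_integrable:
  assumes f: "f \<in> bumps (cbox a b)" and box: "\<And>z. z \<in> cbox a b \<Longrightarrow> m < snd (snd z)" and m: "0 < m"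
    and nz: "(LINT z|lborel. f z * of_real (boundary_kernel i j z)) \<noteq> 0"
  shows "\<not> integrable rho (Riesz2 i j f)"
proof -
  let ?F = "X i (X j f)"
  let ?H = "\<lambda>x. LINT z|lborel. ?F z * of_real (green x z / snd (snd z))"
  let ?U = "{x::point. 0 \<le> snd (snd x) \<and> snd (snd x) \<le> m}"
  have K: "cbox a b \<subseteq> G"
    using box m by (force simp: G_def)
  have F: "?F \<in> bumps (cbox a b)" by (intro bumps_X f)
  have "?H 0 \<noteq> 0"
    unfolding Riesz2_boundary_value[OF f compact_cbox K] by (rule nz)
  then have pos: "0 < cmod (?H 0) / 2" by simp
  have cont: "continuous_on ?U ?H"
    using box m bumps_zero_outside[OF F]
    by (intro green_integral_continuous bumps_continuous[OF F]) auto
  have "0 \<in> ?U" using m by simp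
  from cont[unfolded continuous_on_iff, rule_format, OF this pos] obtain d where d: "0 < d" "\<And>x. x \<in> ?U \<Longrightarrow> dist x 0 < d \<Longrightarrow> dist (?H x) (?H 0) < cmod (?H 0) / 2"
    by auto
  \<comment> \<open>the norm is at most the sum of three coordinates, hence below \<open>d\<close> on the box of size \<open>e\<close>\<close>
  define e where "e = min m (d / 3)"
  show ?thesis
  proof (rule not_integrable_rho_near_boundary)
    show "0 < e" using m d(1) by (simp add: e_def)
    show "0 < cmod (?H 0) / 2" by (rule pos)
    fix x1 x2 t :: real
    assume x: "\<bar>x1\<bar> < e" "\<bar>x2\<bar> < e" "0 < t" "t < e"
    let ?x = "(x1, x2, t)"
    have "norm ?x \<le> \<bar>x1\<bar> + \<bar>x2\<bar> + \<bar>t\<bar>"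
      using norm_Pair_le[of x1 "(x2, t)"] norm_Pair_le[of x2 t] by simp
    also have "\<dots> < d" using x by (simp add: e_def)
    finally have "dist (?H ?x) (?H 0) < cmod (?H 0) / 2"
      using x by (intro d(2)) (simp_all add: e_def)
    then have "cmod (?H 0) / 2 \<le> cmod (?H ?x)"
      using norm_triangle_ineq3[of "?H 0" "?H ?x"] by (simp add: dist_norm norm_minus_commute)
    moreover have "Riesz2 i j f ?x = ?H ?x"
      unfolding Riesz2_def
    proof (rule Laplacian_inverse_eq)
      show "?F \<in> borel_measurable borel"
        by (intro borel_measurable_continuous_onI bumps_continuous[OF F])
      show "?F z = 0" if "z \<notin> G" for z
        using K that by (intro bumps_zero_outside[OF F]) blast
    qed (use x in \<open>simp add: G_def\<close>)
    ultimately show "cmod (?H 0) / 2 \<le> cmod (Riesz2 i j f ?x)" by simp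
  qed
qed

theorem theorem8p2:
  fixes i j :: nat
  assumes "i \<in> {0, 1, 2}" and "j \<in> {0, 1, 2}"
  shows "\<not> bounded_H1_L1 (Riesz2 i j)"
proof -
  let ?p = "(1, 1, 1) :: point" and ?q = "(0, 0, 1) :: point"
  \<comment> \<open>a box that contains the balls of radius \<open>1 / 2\<close> about both points and lies in \<open>unit_CZ_set\<close>\<close>
  let ?K = "cbox (- 1, - 1, 1 / 2) (2, 2, 3 / 2) :: point set"
  obtain r where r: "0 < r" "r \<le> 1 / 2"
    and nz: "(LINT z|lborel. (bump r ?p z - bump r ?q z) * boundary_kernel i j z) \<noteq> 0"
    by (rule bump_difference_integral_nonzero[of "- {0}" "boundary_kernel i j" ?p ?q "1 / 2"])
       (use boundary_kernel_continuous boundary_kernel_distinguishes[OF assms] in \<open>auto simp: zero_prod_def\<close>)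
  have ball: "cball c r \<subseteq> ?K" if "c = ?p \<or> c = ?q" for c
  proof
    fix z assume "z \<in> cball c r"
    then have z: "dist c z \<le> 1 / 2" using r(2) by simp
    obtain z1 z2 b where [simp]: "z = (z1, z2, b)" by (cases z)
    obtain c1 c2 c3 where [simp]: "c = (c1, c2, c3)" by (cases c)
    have "dist c1 z1 \<le> dist c z" "dist c2 z2 \<le> dist c z" "dist c3 b \<le> dist c z"
      using dist_fst_le[of c z] dist_snd_le[of c z] dist_fst_le[of "(c2, c3)" "(z2, b)"]
        dist_snd_le[of "(c2, c3)" "(z2, b)"] by simp_all
    with z that show "z \<in> ?K"
      by (auto simp: cbox_Pair_eq dist_real_def)
  qed
  have KG: "?K \<subseteq> G" by (auto simp: cbox_Pair_eq G_def)
  have KR: "?K \<subseteq> unit_CZ_set"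
  proof -
    have "4 \<le> exp (2::real)" "2 \<le> exp (1::real)"
      using exp_ge_add_one_self[of "1::real"] mult_mono[of 2 "exp 1" 2 "exp (1::real)"]
      by (simp_all flip: exp_add)
    moreover have "exp (- 1) \<le> (1 / 2 :: real)"
      using \<open>2 \<le> exp (1::real)\<close> by (simp add: exp_minus field_simps)
    ultimately show ?thesis by (auto simp: cbox_Pair_eq unit_CZ_set_def)
  qed
  define f where "f z = complex_of_real (bump r ?p z) - of_real (bump r ?q z)" for z
  have f: "f \<in> bumps ?K"
    unfolding f_def[abs_def] by (intro bumps_diff bump_in_bumps r(1) ball) simp_all
  have mult: "(LINT z|lborel. f z * of_real (c z)) = of_real (LINT z|lborel. (bump r ?p z - bump r ?q z) * c z)" for c
  proof -
    have "(\<lambda>z. f z * of_real (c z)) = (\<lambda>z. complex_of_real ((bump r ?p z - bump r ?q z) * c z))"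
      by (simp add: f_def fun_eq_iff)
    then show ?thesis by (simp only: integral_complex_of_real)
  qed
  have mean: "(LINT z|rho. f z) = 0"
  proof -
    have cont: "continuous_on (cball c r) (\<lambda>z::point. 1 / snd (snd z))" if "c = ?p \<or> c = ?q" for c
      using ball[OF that] KG by (intro continuous_intros) (auto simp: G_def)
    have "(LINT z|rho. f z) = (LINT z|lborel. f z * of_real (1 / snd (snd z)))"
      unfolding bumps_integrable_rho(2)[OF f compact_cbox KG] by (simp only: mult.commute)
    also have "\<dots> = of_real (LINT z|lborel. (bump r ?p z - bump r ?q z) * (1 / snd (snd z)))"
      by (rule mult)
    also have "(LINT z|lborel. (bump r ?p z - bump r ?q z) * (1 / snd (snd z))) =
        (LINT z|lborel. bump r 0 z * (1 / snd (snd (?p + z)) - 1 / snd (snd (?q + z))))"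
      by (rule bump_difference_integral[OF r(1)]) (simp_all only: cont simp_thms)
    also have "\<dots> = 0" by simp
    finally show ?thesis by simp
  qed
  have "\<not> integrable rho (Riesz2 i j f)"
  proof (rule Riesz2_not_integrable[OF f])
    \<comment> \<open>any height strictly between \<open>0\<close> and the bottom of the box serves here\<close>
    show "1 / 4 < snd (snd z)" if "z \<in> ?K" for z
      using that by (auto simp: cbox_Pair_eq)
    show "(LINT z|lborel. f z * of_real (boundary_kernel i j z)) \<noteq> 0"
      unfolding mult using nz by simp
  qed simp
  then have infinite: "L1_norm (Riesz2 i j f) = \<infinity>" by (simp add: L1_norm_def)
  have test: "f \<in> Cc_infinity \<inter> H1"
    using bumps_Cc_infinity[OF f compact_cbox KG] bumps_in_H1[OF f compact_cbox KG KR mean] by blast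
  show ?thesis
  proof
    assume "bounded_H1_L1 (Riesz2 i j)"
    then obtain C where "L1_norm (Riesz2 i j f) \<le> ennreal (C * H1_norm f)"
      unfolding bounded_H1_L1_def using test by blast
    then show False by (simp add: infinite top_unique)
  qed
qed

end
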